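(* Let $p=2$ and let $n$ be a positive integer. For an integer $e\ge1$, consider the number of integers $x$ with $1\le x\le p^e$ and $p\nmid x$ such that $x^{x^n}\equiv x\pmod{p^e}$. When $n$ is even, this number is $$\begin{cases}2p^{e-2}&\text{if } 1\le e\le 4+v_p(n),\\ 2p^{\lfloor (e+v_p(n))/2\rfloor}&\text{if } e\ge 5+v_p(n).\end{cases}$$ When $n$ is odd, this number is $$\begin{cases}2p^{e-2}&\text{if } 1\le e\le 3,\\ p^{\lfloor e/2\rfloor}+p&\text{if } e\ge 4.\end{cases}$$ In either case the only solutions $x\in\mathbb{Z}_p$ with $p\nmid x$ to the equation $\omega(x)\langle x\rangle^{x^n}=x$ are $x=1$ and $x=-1$.
   Context: Throughout $p=2$. $\mathbb{Z}_2$ is the ring of $2$-adic integers, $v_2$ the $2$-adic valuation. For $x\in\mathbb{Z}_2^\times$, $\omega(x)\in\{1,-1\}$ is determined by $\omega(x)\equiv x\pmod 4$, and $\langle x\rangle=x/\omega(x)\in 1+4\mathbb{Z}_2$; for $z\in\mathbb{Z}_2$, $\langle x\rangle^{z}=\exp(z\log\langle x\rangle)$. *)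

theory Defs
  imports Complex_Main "HOL-Number_Theory.Cong" "HOL-Computational_Algebra.Primes"
begin

section \<open>The 2-adic absolute value on the rationals\<close>

definition val2 :: "rat \<Rightarrow> int" where
  "val2 q = int (multiplicity 2 (fst (quotient_of q))) - int (multiplicity 2 (snd (quotient_of q)))"

definition abs2 :: "rat \<Rightarrow> real" where
  "abs2 q = (if q = 0 then 0 else 2 powi (- val2 q))"

lemma val2_divide:
  assumes "a \<noteq> 0" "b \<noteq> 0"
  shows "val2 (of_int a / of_int b) = int (multiplicity 2 a) - int (multiplicity 2 b)"
proof -
  define c d where "c = fst (quotient_of (of_int a / of_int b))"
    and "d = snd (quotient_of (of_int a / of_int b))"
  have d0: "d > 0" by (simp add: d_def quotient_of_denom_pos')
  have eq: "(of_int a / of_int b :: rat) = of_int c / of_int d"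
    using quotient_of_div[of "of_int a / of_int b" c d] by (simp add: c_def d_def)
  with assms d0 have "(of_int (a * d) :: rat) = of_int (c * b)"
    by (simp add: field_simps)
  then have ad: "a * d = c * b" by (simp only: of_int_eq_iff)
  with assms d0 have c0: "c \<noteq> 0" by auto
  have "multiplicity 2 (a * d) = multiplicity 2 a + multiplicity 2 d"
    using assms d0 by (intro prime_elem_multiplicity_mult_distrib) auto
  moreover have "multiplicity 2 (c * b) = multiplicity 2 c + multiplicity 2 b"
    using assms c0 by (intro prime_elem_multiplicity_mult_distrib) auto
  ultimately show ?thesis
    unfolding val2_def c_def[symmetric] d_def[symmetric] using ad by simp
qed

lemma rat_eq_divide:
  fixes q :: rat
  obtains a b :: int where "q = of_int a / of_int b" "b > 0"
  using quotient_of_div[of q] quotient_of_denom_pos'[of q] by (metis prod.collapse)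

lemma abs2_0 [simp]: "abs2 0 = 0"
  by (simp add: abs2_def)

lemma abs2_eq_0_iff [simp]: "abs2 q = 0 \<longleftrightarrow> q = 0"
  by (simp add: abs2_def)

lemma abs2_nonneg [simp]: "abs2 q \<ge> 0"
  by (simp add: abs2_def)

lemma abs2_pos: "q \<noteq> 0 \<Longrightarrow> abs2 q > 0"
  by (simp add: abs2_def)

lemma abs2_1 [simp]: "abs2 1 = 1"
  by (simp add: abs2_def val2_def)

lemma abs2_minus [simp]: "abs2 (- q) = abs2 q"
  using multiplicity_times_unit_right[of "-1" 2 "fst (quotient_of q)"]
  by (simp add: abs2_def val2_def rat_uminus_code case_prod_beta)

lemma abs2_minus_commute: "abs2 (p - q) = abs2 (q - p)"
  by (metis abs2_minus minus_diff_eq)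

lemma abs2_mult: "abs2 (p * q) = abs2 p * abs2 q"
proof (cases "p = 0 \<or> q = 0")
  case False
  obtain a b where p: "p = of_int a / of_int b" "b > 0" by (rule rat_eq_divide)
  obtain c d where q: "q = of_int c / of_int d" "d > 0" by (rule rat_eq_divide)
  have nz: "a \<noteq> 0" "c \<noteq> 0" using False p q by auto
  have "val2 (p * q) = val2 p + val2 q"
    using val2_divide[of "a * c" "b * d"] p q nz
    by (simp add: val2_divide prime_elem_multiplicity_mult_distrib)
  then show ?thesis
    using False by (simp add: abs2_def power_int_diff power_int_minus divide_inverse)
qed auto

lemma abs2_inverse: "abs2 (inverse q) = inverse (abs2 q)"
  by (cases "q = 0") (simp_all add: abs2_mult[symmetric] inverse_unique[symmetric])

lemma abs2_add_le_max: "abs2 (p + q) \<le> max (abs2 p) (abs2 q)"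
proof (cases "p = 0 \<or> q = 0 \<or> p + q = 0")
  case False
  obtain a b where p: "p = of_int a / of_int b" "b > 0" by (rule rat_eq_divide)
  obtain c d where q: "q = of_int c / of_int d" "d > 0" by (rule rat_eq_divide)
  define x y m where "x = a * d" and "y = c * b" and "m = b * d"
  have m: "m \<noteq> 0" and px: "p = of_int x / of_int m" and qy: "q = of_int y / of_int m"
    using p q by (auto simp: x_def y_def m_def)
  have pq: "p + q = of_int (x + y) / of_int m"
    using px qy by (simp add: add_divide_distrib)
  have nz: "x \<noteq> 0" "y \<noteq> 0" "x + y \<noteq> 0" using False px qy pq by auto
  define k where "k = min (multiplicity 2 x) (multiplicity 2 y)"
  have "2 ^ k dvd x + y"
    by (intro dvd_add multiplicity_dvd') (auto simp: k_def)
  then have "k \<le> multiplicity 2 (x + y)"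
    using nz(3) by (subst power_dvd_iff_le_multiplicity[symmetric]) auto
  then have "min (val2 p) (val2 q) \<le> val2 (p + q)"
    using nz m val2_divide[of "x + y" m] unfolding pq by (simp add: px qy val2_divide k_def)
  then have "val2 p \<le> val2 (p + q) \<or> val2 q \<le> val2 (p + q)" by linarith
  moreover have "(2::real) powi (- j) \<le> 2 powi (- i)" if "i \<le> j" for i j
    using that by (intro power_int_increasing) auto
  ultimately show ?thesis
    using False by (auto simp: abs2_def le_max_iff_disj)
qed (auto simp: le_max_iff_disj)

lemma abs2_triangle: "abs2 (p + q) \<le> abs2 p + abs2 q"
  using abs2_add_le_max[of p q] abs2_nonneg[of p] abs2_nonneg[of q] by linarith

lemma abs_abs2_diff_le: "\<bar>abs2 p - abs2 q\<bar> \<le> abs2 (p - q)"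
  using abs2_triangle[of "p - q" q] abs2_triangle[of "q - p" p] abs2_minus_commute[of p q] by simp


section \<open>The field of 2-adic numbers, as the completion of the rationals\<close>

definition cauchy2 :: "(nat \<Rightarrow> rat) \<Rightarrow> bool" where
  "cauchy2 X \<longleftrightarrow> (\<forall>r>0. \<exists>k. \<forall>m\<ge>k. \<forall>n\<ge>k. abs2 (X m - X n) < r)"

definition null2 :: "(nat \<Rightarrow> rat) \<Rightarrow> bool" where
  "null2 X \<longleftrightarrow> (\<lambda>n. abs2 (X n)) \<longlonglongrightarrow> 0"

lemma null2_const [simp]: "null2 (\<lambda>n. c) \<longleftrightarrow> c = 0"
  by (simp add: null2_def LIMSEQ_const_iff)

lemma null2I:
  assumes "f \<longlonglongrightarrow> 0" "\<And>n. abs2 (X n) \<le> f n"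
  shows "null2 X"
  unfolding null2_def
  by (rule tendsto_sandwich[OF _ _ tendsto_const assms(1)]) (auto simp: assms(2))

lemma null2_minus: "null2 X \<Longrightarrow> null2 (\<lambda>n. - X n)"
  by (simp add: null2_def)

lemma null2_add:
  assumes "null2 X" "null2 Y"
  shows "null2 (\<lambda>n. X n + Y n)"
proof -
  have "(\<lambda>n. abs2 (X n) + abs2 (Y n)) \<longlonglongrightarrow> 0"
    using tendsto_add[OF assms[unfolded null2_def]] by simp
  then show ?thesis by (rule null2I) (rule abs2_triangle)
qed

lemma null2_diff: "null2 X \<Longrightarrow> null2 Y \<Longrightarrow> null2 (\<lambda>n. X n - Y n)"
  using null2_add[OF _ null2_minus] by simp

lemma null2_mult_bounded:
  assumes "\<And>n. abs2 (X n) \<le> B" "null2 Y"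
  shows "null2 (\<lambda>n. X n * Y n)"
proof -
  have "(\<lambda>n. B * abs2 (Y n)) \<longlonglongrightarrow> 0"
    using tendsto_mult_left[OF assms(2)[unfolded null2_def], of B] by simp
  then show ?thesis by (rule null2I) (simp add: abs2_mult assms(1) mult_right_mono)
qed

lemma cauchy2_const [simp]: "cauchy2 (\<lambda>n. c)"
  by (simp add: cauchy2_def)

lemma cauchy2D: "cauchy2 X \<Longrightarrow> r > 0 \<Longrightarrow> \<exists>k. \<forall>m\<ge>k. \<forall>n\<ge>k. abs2 (X m - X n) < r"
  by (simp add: cauchy2_def)

lemma cauchy2_bounded:
  assumes "cauchy2 X"
  obtains B where "B > 0" "\<And>n. abs2 (X n) \<le> B"
proof -
  obtain k where k: "\<forall>m\<ge>k. \<forall>n\<ge>k. abs2 (X m - X n) < 1"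
    using cauchy2D[OF assms, of 1] by auto
  define B where "B = Max ((\<lambda>n. abs2 (X n)) ` {..k}) + 1"
  have le: "abs2 (X n) \<le> B - 1" if "n \<le> k" for n
    using that by (auto simp: B_def intro!: Max_ge)
  have "abs2 (X n) \<le> B" for n
  proof (cases "n \<le> k")
    case False
    then have "abs2 (X n - X k) < 1" using k by simp
    then show ?thesis
      using abs2_triangle[of "X n - X k" "X k"] le[of k] by simp
  qed (use le[of n] in simp)
  moreover have "B > 0" using le[of k] abs2_nonneg[of "X k"] by linarith
  ultimately show thesis using that by blast
qed

lemma cauchy2_add:
  assumes "cauchy2 X" "cauchy2 Y"
  shows "cauchy2 (\<lambda>n. X n + Y n)"
  unfolding cauchy2_def
proof (intro allI impI)
  fix r :: real assume r: "r > 0"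
  obtain i where i: "\<forall>m\<ge>i. \<forall>n\<ge>i. abs2 (X m - X n) < r" using cauchy2D[OF assms(1) r] by blast
  obtain j where j: "\<forall>m\<ge>j. \<forall>n\<ge>j. abs2 (Y m - Y n) < r" using cauchy2D[OF assms(2) r] by blast
  show "\<exists>k. \<forall>m\<ge>k. \<forall>n\<ge>k. abs2 (X m + Y m - (X n + Y n)) < r"
  proof (intro exI[of _ "max i j"] allI impI)
    fix m n assume "max i j \<le> m" "max i j \<le> n"
    then have "abs2 (X m - X n) < r" "abs2 (Y m - Y n) < r" using i j by auto
    then show "abs2 (X m + Y m - (X n + Y n)) < r"
      using abs2_add_le_max[of "X m - X n" "Y m - Y n"] by (simp add: algebra_simps)
  qed
qed

lemma cauchy2_minus: "cauchy2 X \<Longrightarrow> cauchy2 (\<lambda>n. - X n)"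
  unfolding cauchy2_def by (simp add: abs2_minus_commute)

lemma cauchy2_diff: "cauchy2 X \<Longrightarrow> cauchy2 Y \<Longrightarrow> cauchy2 (\<lambda>n. X n - Y n)"
  using cauchy2_add[OF _ cauchy2_minus] by simp

lemma cauchy2_mult:
  assumes "cauchy2 X" "cauchy2 Y"
  shows "cauchy2 (\<lambda>n. X n * Y n)"
  unfolding cauchy2_def
proof (intro allI impI)
  fix r :: real assume r: "r > 0"
  obtain A where A: "A > 0" "\<And>n. abs2 (X n) \<le> A" using cauchy2_bounded[OF assms(1)] by blast
  obtain B where B: "B > 0" "\<And>n. abs2 (Y n) \<le> B" using cauchy2_bounded[OF assms(2)] by blast
  obtain i where i: "\<forall>m\<ge>i. \<forall>n\<ge>i. abs2 (X m - X n) < r / B"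
    using cauchy2D[OF assms(1), of "r / B"] r B by auto
  obtain j where j: "\<forall>m\<ge>j. \<forall>n\<ge>j. abs2 (Y m - Y n) < r / A"
    using cauchy2D[OF assms(2), of "r / A"] r A by auto
  show "\<exists>k. \<forall>m\<ge>k. \<forall>n\<ge>k. abs2 (X m * Y m - X n * Y n) < r"
  proof (intro exI[of _ "max i j"] allI impI)
    fix m n assume "max i j \<le> m" "max i j \<le> n"
    then have le: "abs2 (X m - X n) < r / B" "abs2 (Y m - Y n) < r / A" using i j by auto
    have "abs2 (X m * (Y m - Y n)) \<le> A * abs2 (Y m - Y n)"
      by (simp add: abs2_mult A mult_right_mono)
    also have "\<dots> < r" using le(2) A(1) by (simp add: field_simps)
    finally have 1: "abs2 (X m * (Y m - Y n)) < r" .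
    have "abs2 ((X m - X n) * Y n) \<le> abs2 (X m - X n) * B"
      by (simp add: abs2_mult B mult_left_mono)
    also have "\<dots> < r" using le(1) B(1) by (simp add: field_simps)
    finally have 2: "abs2 ((X m - X n) * Y n) < r" .
    show "abs2 (X m * Y m - X n * Y n) < r"
      using 1 2 abs2_add_le_max[of "X m * (Y m - Y n)" "(X m - X n) * Y n"]
      by (simp add: algebra_simps)
  qed
qed

lemma cauchy2_not_null2:
  assumes "cauchy2 X" "\<not> null2 X"
  obtains b k where "b > 0" "\<And>n. n \<ge> k \<Longrightarrow> b \<le> abs2 (X n)"
proof -
  obtain r where r: "r > 0" and far: "\<And>k. \<exists>n\<ge>k. r \<le> abs2 (X n)"
    using assms(2) unfolding null2_def LIMSEQ_iff by (auto simp: not_less)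
  obtain k where k: "\<forall>m\<ge>k. \<forall>n\<ge>k. abs2 (X m - X n) < r / 2"
    using cauchy2D[OF assms(1), of "r / 2"] r by auto
  obtain m where m: "m \<ge> k" "r \<le> abs2 (X m)" using far by blast
  have "r / 2 \<le> abs2 (X n)" if "n \<ge> k" for n
  proof -
    have "abs2 (X m - X n) < r / 2" using k m(1) that by simp
    then show ?thesis
      using abs2_triangle[of "X m - X n" "X n"] m(2) by simp
  qed
  then show thesis using that[of "r / 2" k] r by auto
qed

lemma abs2_inverse_diff:
  assumes "b > 0" "b \<le> abs2 p" "b \<le> abs2 q"
  shows "abs2 (inverse p - inverse q) \<le> abs2 (p - q) / b\<^sup>2"
proof -
  have nz: "p \<noteq> 0" "q \<noteq> 0" using assms by auto
  then have "inverse p - inverse q = inverse p * inverse q * (q - p)"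
    by (simp add: field_simps)
  then have "abs2 (inverse p - inverse q) = abs2 (inverse p * inverse q * (q - p))"
    by (rule arg_cong)
  also have "\<dots> = abs2 (p - q) / (abs2 p * abs2 q)"
    by (simp only: abs2_mult abs2_inverse abs2_minus_commute[of q p]) (simp add: field_simps)
  also have "\<dots> \<le> abs2 (p - q) / b\<^sup>2"
    using assms by (intro divide_left_mono) (auto simp: power2_eq_square intro!: mult_mono mult_pos_pos)
  finally show ?thesis .
qed

lemma cauchy2_inverse:
  assumes "cauchy2 X" "\<not> null2 X"
  shows "cauchy2 (\<lambda>n. inverse (X n))"
  unfolding cauchy2_def
proof (intro allI impI)
  fix r :: real assume r: "r > 0"
  obtain b i where b: "b > 0" "\<And>n. n \<ge> i \<Longrightarrow> b \<le> abs2 (X n)"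
    by (rule cauchy2_not_null2[OF assms]) blast
  obtain j where j: "\<forall>m\<ge>j. \<forall>n\<ge>j. abs2 (X m - X n) < r * b\<^sup>2"
    using cauchy2D[OF assms(1), of "r * b\<^sup>2"] r b by auto
  show "\<exists>k. \<forall>m\<ge>k. \<forall>n\<ge>k. abs2 (inverse (X m) - inverse (X n)) < r"
  proof (intro exI[of _ "max i j"] allI impI)
    fix m n assume mn: "max i j \<le> m" "max i j \<le> n"
    then have "abs2 (inverse (X m) - inverse (X n)) \<le> abs2 (X m - X n) / b\<^sup>2"
      using b by (intro abs2_inverse_diff) auto
    also have "\<dots> < r" using mn j b(1) by (simp add: field_simps)
    finally show "abs2 (inverse (X m) - inverse (X n)) < r" .
  qed
qed

lemma null2_diff_inverse:
  assumes X: "cauchy2 X" "\<not> null2 X" and Y: "cauchy2 Y" "\<not> null2 Y"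
    and XY: "null2 (\<lambda>n. X n - Y n)"
  shows "null2 (\<lambda>n. inverse (X n) - inverse (Y n))"
proof -
  obtain a i where a: "a > 0" "\<And>n. n \<ge> i \<Longrightarrow> a \<le> abs2 (X n)"
    by (rule cauchy2_not_null2[OF X]) blast
  obtain b j where b: "b > 0" "\<And>n. n \<ge> j \<Longrightarrow> b \<le> abs2 (Y n)"
    by (rule cauchy2_not_null2[OF Y]) blast
  define c where "c = min a b"
  have c: "c > 0" "c \<le> a" "c \<le> b" using a b by (auto simp: c_def)
  have lim: "(\<lambda>n. abs2 (X n - Y n) / c\<^sup>2) \<longlonglongrightarrow> 0"
    using tendsto_divide[OF XY[unfolded null2_def] tendsto_const, of "c\<^sup>2"] c by simp
  have "\<forall>\<^sub>F n in sequentially. abs2 (inverse (X n) - inverse (Y n)) \<le> abs2 (X n - Y n) / c\<^sup>2"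
    using eventually_ge_at_top[of "max i j"]
  proof eventually_elim
    case (elim n)
    then have "a \<le> abs2 (X n)" "b \<le> abs2 (Y n)" using a b by auto
    then show ?case using c by (intro abs2_inverse_diff) auto
  qed
  then show ?thesis
    unfolding null2_def by (intro tendsto_sandwich[OF _ _ tendsto_const lim]) auto
qed

definition rel2 :: "(nat \<Rightarrow> rat) \<Rightarrow> (nat \<Rightarrow> rat) \<Rightarrow> bool" where
  "rel2 X Y \<longleftrightarrow> cauchy2 X \<and> cauchy2 Y \<and> null2 (\<lambda>n. X n - Y n)"

lemma part_equivp_rel2: "part_equivp rel2"
proof (rule part_equivpI)
  show "\<exists>X. rel2 X X" by (rule exI[of _ "\<lambda>n. 0"]) (simp add: rel2_def)
  show "symp rel2"
    by (rule sympI) (auto simp: rel2_def null2_def abs2_minus_commute)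
  show "transp rel2"
    by (rule transpI) (auto simp: rel2_def dest: null2_add)
qed

quotient_type two_adic = "nat \<Rightarrow> rat" / partial: rel2
  morphisms rep_two_adic Abs_two_adic
  by (rule part_equivp_rel2)

lemma Domainp_pcr_two_adic [transfer_domain_rule]: "Domainp pcr_two_adic = cauchy2"
  by (auto simp: two_adic.domain_eq rel2_def)

lemma rel2_refl: "cauchy2 X \<Longrightarrow> rel2 X X"
  by (simp add: rel2_def)

instantiation two_adic :: field
begin

lift_definition zero_two_adic :: two_adic is "\<lambda>n. 0"
  by (simp add: rel2_def)

lift_definition one_two_adic :: two_adic is "\<lambda>n. 1"
  by (simp add: rel2_def)

lift_definition plus_two_adic :: "two_adic \<Rightarrow> two_adic \<Rightarrow> two_adic" is "\<lambda>X Y n. X n + Y n"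
  unfolding rel2_def by (auto simp: add_diff_add intro: cauchy2_add null2_add)

lift_definition uminus_two_adic :: "two_adic \<Rightarrow> two_adic" is "\<lambda>X n. - X n"
  unfolding rel2_def null2_def
  by (auto simp: abs2_minus_commute[of _ "_ :: rat"] intro: cauchy2_minus)

lift_definition minus_two_adic :: "two_adic \<Rightarrow> two_adic \<Rightarrow> two_adic" is "\<lambda>X Y n. X n - Y n"
  unfolding rel2_def by (auto simp: diff_diff_add diff_add_eq add_diff_eq intro: cauchy2_diff)
    (drule (1) null2_diff, simp add: algebra_simps)

lift_definition times_two_adic :: "two_adic \<Rightarrow> two_adic \<Rightarrow> two_adic" is "\<lambda>X Y n. X n * Y n"
proof -
  fix X X' Y Y' assume "rel2 X X'" "rel2 Y Y'"
  then have c: "cauchy2 X" "cauchy2 X'" "cauchy2 Y" "cauchy2 Y'"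
    and n: "null2 (\<lambda>n. X n - X' n)" "null2 (\<lambda>n. Y n - Y' n)"
    by (auto simp: rel2_def)
  obtain A where A: "\<And>n. abs2 (X n) \<le> A" using cauchy2_bounded[OF c(1)] by blast
  obtain B where B: "\<And>n. abs2 (Y' n) \<le> B" using cauchy2_bounded[OF c(4)] by blast
  have "null2 (\<lambda>n. X n * (Y n - Y' n) + Y' n * (X n - X' n))"
    by (intro null2_add null2_mult_bounded[OF A] null2_mult_bounded[OF B] n)
  then have "null2 (\<lambda>n. X n * Y n - X' n * Y' n)"
    by (simp add: algebra_simps)
  then show "rel2 (\<lambda>n. X n * Y n) (\<lambda>n. X' n * Y' n)"
    using c by (simp add: rel2_def cauchy2_mult)
qed

lift_definition inverse_two_adic :: "two_adic \<Rightarrow> two_adic"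
  is "\<lambda>X. if null2 X then (\<lambda>n. 0) else (\<lambda>n. inverse (X n))"
proof -
  fix X Y assume "rel2 X Y"
  then have c: "cauchy2 X" "cauchy2 Y" and n: "null2 (\<lambda>n. X n - Y n)"
    by (auto simp: rel2_def)
  have "null2 X \<longleftrightarrow> null2 Y"
    using null2_diff[OF _ n, of X] null2_add[OF _ n, of Y] by auto
  then show "?thesis X Y"
    using c n by (auto simp: rel2_def cauchy2_inverse null2_diff_inverse)
qed

definition divide_two_adic :: "two_adic \<Rightarrow> two_adic \<Rightarrow> two_adic" where
  "divide_two_adic x y = x * inverse y"

instance
proof
  fix a b c :: two_adic
  show "a + b = b + a" by transfer (simp add: rel2_refl cauchy2_add add.commute)
  show "a + b + c = a + (b + c)" by transfer (simp add: rel2_refl cauchy2_add add.assoc)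
  show "0 + a = a" by transfer (simp add: rel2_refl)
  show "- a + a = 0" by transfer (simp add: rel2_refl)
  show "a - b = a + - b" by transfer (simp add: rel2_refl cauchy2_diff)
  show "a * b * c = a * (b * c)" by transfer (simp add: rel2_refl cauchy2_mult mult.assoc)
  show "a * b = b * a" by transfer (simp add: rel2_refl cauchy2_mult mult.commute)
  show "1 * a = a" by transfer (simp add: rel2_refl)
  show "(a + b) * c = a * c + b * c"
    by transfer (simp add: rel2_refl cauchy2_add cauchy2_mult distrib_right)
  show "(0::two_adic) \<noteq> 1" by transfer (simp add: rel2_def)
  show "inverse (0::two_adic) = 0" by transfer (simp add: rel2_def)
  show "a div b = a * inverse b" by (rule divide_two_adic_def)
  have inv: "rel2 (\<lambda>n. inverse (X n) * X n) (\<lambda>n. 1)" if X: "cauchy2 X" "\<not> null2 X" for X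
  proof -
    obtain b k where b: "b > 0" "\<And>n. n \<ge> k \<Longrightarrow> b \<le> abs2 (X n)"
      by (rule cauchy2_not_null2[OF X]) blast
    have "\<forall>\<^sub>F n in sequentially. 0 = abs2 (inverse (X n) * X n - 1)"
      using eventually_ge_at_top[of k]
    proof eventually_elim
      case (elim n)
      then have "X n \<noteq> 0" using b(1) b(2)[of n] by auto
      then show ?case by simp
    qed
    then have "null2 (\<lambda>n. inverse (X n) * X n - 1)"
      unfolding null2_def by (rule Lim_transform_eventually[OF tendsto_const])
    then show ?thesis using X by (simp add: rel2_def cauchy2_mult cauchy2_inverse)
  qed
  show "a \<noteq> 0 \<Longrightarrow> inverse a * a = 1"
    by transfer (auto simp: rel2_def[of _ "\<lambda>n. 0"] inv)
qed

end

lemma convergent_abs2: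
  assumes "cauchy2 X"
  shows "convergent (\<lambda>n. abs2 (X n))"
proof (rule Cauchy_convergent, rule metric_CauchyI)
  fix r :: real assume r: "r > 0"
  obtain k where k: "\<forall>m\<ge>k. \<forall>n\<ge>k. abs2 (X m - X n) < r" using cauchy2D[OF assms r] by blast
  show "\<exists>M. \<forall>m\<ge>M. \<forall>n\<ge>M. dist (abs2 (X m)) (abs2 (X n)) < r"
    unfolding dist_real_def using k by (blast intro: le_less_trans[OF abs_abs2_diff_le])
qed

text \<open>
  The overloaded constant \<open>norm\<close> is restricted to real normed vector spaces, so the 2-adic
  absolute value gets a name of its own.
\<close>

lift_definition norm2 :: "two_adic \<Rightarrow> real" is "\<lambda>X. lim (\<lambda>n. abs2 (X n))"
proof -
  fix X Y assume r: "rel2 X Y"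
  then have X: "(\<lambda>n. abs2 (X n)) \<longlonglongrightarrow> lim (\<lambda>n. abs2 (X n))"
    and n: "(\<lambda>n. abs2 (X n - Y n)) \<longlonglongrightarrow> 0"
    using convergent_abs2 by (auto simp: convergent_LIMSEQ_iff rel2_def null2_def)
  have "(\<lambda>n. abs2 (Y n) - abs2 (X n)) \<longlonglongrightarrow> 0"
    by (rule tendsto_rabs_zero_cancel, rule tendsto_sandwich[OF _ _ tendsto_const n])
       (auto simp: abs_abs2_diff_le abs2_minus_commute[of "X _"])
  from tendsto_add[OF this X] have "(\<lambda>n. abs2 (Y n)) \<longlonglongrightarrow> lim (\<lambda>n. abs2 (X n))" by simp
  then show "lim (\<lambda>n. abs2 (X n)) = lim (\<lambda>n. abs2 (Y n))" by (simp add: limI)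
qed

instantiation two_adic :: metric_space
begin

definition dist_two_adic :: "two_adic \<Rightarrow> two_adic \<Rightarrow> real" where
  "dist_two_adic x y = norm2 (x - y)"

definition uniformity_two_adic :: "(two_adic \<times> two_adic) filter" where
  "uniformity_two_adic = (INF e\<in>{0 <..}. principal {(x, y). dist x y < e})"

definition open_two_adic :: "two_adic set \<Rightarrow> bool" where
  "open_two_adic U \<longleftrightarrow> (\<forall>x\<in>U. \<forall>\<^sub>F (x', y) in uniformity. x' = x \<longrightarrow> y \<in> U)"

instance
proof
  fix x y z :: two_adic and U :: "two_adic set"
  show "uniformity = (INF e\<in>{0 <..}. principal {(x::two_adic, y). dist x y < e})"
    by (rule uniformity_two_adic_def)
  show "open U \<longleftrightarrow> (\<forall>x\<in>U. \<forall>\<^sub>F (x', y) in uniformity. x' = x \<longrightarrow> y \<in> U)"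
    by (rule open_two_adic_def)
  have "norm2 w = 0 \<longleftrightarrow> w = 0" for w :: two_adic
    by transfer (auto simp: rel2_def null2_def convergent_LIMSEQ_iff[symmetric] limI
        dest: convergent_abs2 simp: convergent_LIMSEQ_iff)
  then show "dist x y = 0 \<longleftrightarrow> x = y" by (simp add: dist_two_adic_def)
  have "norm2 (x - y) \<le> norm2 (x - z) + norm2 (y - z)"
  proof (transfer, goal_cases)
    case (1 X Y Z)
    have lim: "(\<lambda>n. abs2 (W n - V n)) \<longlonglongrightarrow> lim (\<lambda>n. abs2 (W n - V n))"
      if "cauchy2 W" "cauchy2 V" for W V
      using convergent_abs2[OF cauchy2_diff[OF that]] by (simp add: convergent_LIMSEQ_iff)
    show ?case
    proof (rule LIMSEQ_le[OF lim[OF 1(1,2)] tendsto_add[OF lim[OF 1(1,3)] lim[OF 1(2,3)]]],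
        intro exI allI impI)
      fix n
      show "abs2 (X n - Y n) \<le> abs2 (X n - Z n) + abs2 (Y n - Z n)"
        using abs2_triangle[of "X n - Z n" "Z n - Y n"] abs2_minus_commute[of "Z n" "Y n"] by simp
    qed
  qed
  then show "dist x y \<le> dist x z + dist y z" by (simp add: dist_two_adic_def)
qed

end

lemma Abs_two_adic_cases:
  obtains X where "cauchy2 X" "x = Abs_two_adic X"
  by (metis rel2_def Quotient_two_adic Quotient_abs_rep Quotient_rep_reflp)

lemma Abs_two_adic_transfer: "cauchy2 X \<Longrightarrow> pcr_two_adic X (Abs_two_adic X)"
  by (simp add: two_adic.pcr_cr_eq cr_two_adic_def rel2_def)

lemma norm2_Abs:
  "cauchy2 X \<Longrightarrow> (\<lambda>n. abs2 (X n)) \<longlonglongrightarrow> norm2 (Abs_two_adic X)"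
  using convergent_abs2 by (simp add: norm2.abs_eq rel2_refl convergent_LIMSEQ_iff)

lemma norm2_mult: "norm2 (x * y) = norm2 x * norm2 (y :: two_adic)"
proof -
  obtain X Y where "cauchy2 X" "x = Abs_two_adic X" "cauchy2 Y" "y = Abs_two_adic Y"
    by (metis Abs_two_adic_cases)
  then show ?thesis
    using LIMSEQ_unique[OF norm2_Abs[of "\<lambda>n. X n * Y n"]
        tendsto_mult[OF norm2_Abs[of X] norm2_Abs[of Y], folded abs2_mult]]
    by (simp add: times_two_adic.abs_eq rel2_refl cauchy2_mult)
qed

lemma norm2_add_le_max: "norm2 (x + y) \<le> max (norm2 x) (norm2 (y :: two_adic))"
proof -
  obtain X Y where *: "cauchy2 X" "x = Abs_two_adic X" "cauchy2 Y" "y = Abs_two_adic Y"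
    by (metis Abs_two_adic_cases)
  have "norm2 (Abs_two_adic (\<lambda>n. X n + Y n)) \<le> max (norm2 (Abs_two_adic X)) (norm2 (Abs_two_adic Y))"
    by (rule LIMSEQ_le[OF norm2_Abs tendsto_max[OF norm2_Abs norm2_Abs]])
       (use * in \<open>auto simp: cauchy2_add abs2_add_le_max\<close>)
  with * show ?thesis by (simp add: plus_two_adic.abs_eq rel2_refl)
qed

lemma of_nat_two_adic: "(of_nat k :: two_adic) = Abs_two_adic (\<lambda>_. of_nat k)"
proof (induction k)
  case 0
  show ?case by (simp add: zero_two_adic_def)
next
  case (Suc k)
  then show ?case by (simp add: one_two_adic_def plus_two_adic.abs_eq rel2_refl)
qed

instance two_adic :: field_char_0
proof
  have "of_nat i = (of_nat j :: two_adic) \<longleftrightarrow> i = j" for i j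
    unfolding of_nat_two_adic
    using Quotient_rel[OF Quotient_two_adic, of "\<lambda>_. of_nat i" "\<lambda>_. of_nat j"]
    by (simp add: rel2_def)
  then show "inj (of_nat :: nat \<Rightarrow> two_adic)" by (simp add: inj_def)
qed

lemma of_rat_two_adic: "(of_rat q :: two_adic) = Abs_two_adic (\<lambda>_. q)"
proof -
  have int: "(of_int a :: two_adic) = Abs_two_adic (\<lambda>_. of_int a)" for a
    by (cases a) (simp_all add: of_nat_two_adic one_two_adic_def uminus_two_adic.abs_eq
        minus_two_adic.abs_eq rel2_refl)
  obtain a b where q: "q = of_int a / of_int b" "b > 0" by (rule rat_eq_divide)
  have "Abs_two_adic (\<lambda>_. q) * of_int b = of_int a"
    using q by (simp add: int times_two_adic.abs_eq rel2_refl)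
  then have "Abs_two_adic (\<lambda>_. q) = of_int a / of_int b"
    using q(2) by (simp add: field_simps)
  then show ?thesis by (simp add: q(1) of_rat_divide)
qed

lemma norm2_of_rat: "norm2 (of_rat q :: two_adic) = abs2 q"
  using LIMSEQ_unique[OF norm2_Abs[of "\<lambda>_. q"] tendsto_const] by (simp add: of_rat_two_adic)

lemma Abs_two_adic_LIMSEQ:
  assumes "cauchy2 X"
  shows "(\<lambda>n. of_rat (X n)) \<longlonglongrightarrow> Abs_two_adic X"
proof (rule metric_LIMSEQ_I)
  fix r :: real assume r: "r > 0"
  obtain k where k: "\<forall>m\<ge>k. \<forall>n\<ge>k. abs2 (X m - X n) < r / 2"
    using cauchy2D[OF assms, of "r / 2"] r by auto
  have "dist (of_rat (X n)) (Abs_two_adic X) < r" if "n \<ge> k" for n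
  proof -
    have "(\<lambda>m. abs2 (X n - X m)) \<longlonglongrightarrow> norm2 (Abs_two_adic (\<lambda>m. X n - X m))"
      by (intro norm2_Abs cauchy2_diff assms cauchy2_const)
    then have "norm2 (Abs_two_adic (\<lambda>m. X n - X m)) \<le> r / 2"
      by (rule LIMSEQ_le_const2) (use k that in \<open>auto intro!: exI[of _ k] less_imp_le\<close>)
    then show ?thesis
      using r assms by (simp add: dist_two_adic_def of_rat_two_adic minus_two_adic.abs_eq rel2_refl)
  qed
  then show "\<exists>k. \<forall>n\<ge>k. dist (of_rat (X n)) (Abs_two_adic X) < r" by blast
qed

lemma two_adic_rat_dense:
  assumes "r > 0"
  obtains q where "dist x (of_rat q :: two_adic) < r"
proof -
  obtain X where X: "cauchy2 X" "x = Abs_two_adic X" by (rule Abs_two_adic_cases)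
  from metric_LIMSEQ_D[OF Abs_two_adic_LIMSEQ[OF X(1)] assms] show thesis
    using that X(2) by (metis dist_commute order_refl)
qed

instance two_adic :: complete_space
proof
  fix x :: "nat \<Rightarrow> two_adic" assume x: "Cauchy x"
  have "\<exists>q. dist (x n) (of_rat q) < inverse (real (Suc n))" for n
    using two_adic_rat_dense[of "inverse (real (Suc n))" "x n"] by auto
  then obtain q where q: "\<And>n. dist (x n) (of_rat (q n)) < inverse (real (Suc n))" by metis
  have lim: "(\<lambda>n. dist (x n) (of_rat (q n))) \<longlonglongrightarrow> 0"
    by (rule tendsto_sandwich[OF _ _ tendsto_const LIMSEQ_inverse_real_of_nat])
       (rule always_eventually, rule allI, rule less_imp_le[OF q] zero_le_dist)+
  have "cauchy2 q"
    unfolding cauchy2_def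
  proof (intro allI impI)
    fix r :: real assume r: "r > 0"
    obtain i where i: "\<And>n. n \<ge> i \<Longrightarrow> dist (x n) (of_rat (q n)) < r / 3"
      using order_tendstoD(2)[OF lim, of "r / 3"] r by (auto simp: eventually_sequentially)
    obtain j where j: "\<And>m n. m \<ge> j \<Longrightarrow> n \<ge> j \<Longrightarrow> dist (x m) (x n) < r / 3"
      using metric_CauchyD[OF x, of "r / 3"] r by auto
    have "abs2 (q m - q n) < r" if "m \<ge> max i j" "n \<ge> max i j" for m n
    proof -
      have "abs2 (q m - q n) = dist (of_rat (q m)) (of_rat (q n) :: two_adic)"
        by (simp add: dist_two_adic_def norm2_of_rat of_rat_diff[symmetric])
      also have "\<dots> < r"
        using i[of m] i[of n] j[of m n] that
          dist_triangle[of "of_rat (q m)" "of_rat (q n)" "x m"]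
          dist_triangle[of "x m" "of_rat (q n)" "x n"]
        by (auto simp: dist_commute)
      finally show ?thesis .
    qed
    then show "\<exists>k. \<forall>m\<ge>k. \<forall>n\<ge>k. abs2 (q m - q n) < r" by blast
  qed
  from Abs_two_adic_LIMSEQ[OF this] have *: "(\<lambda>n. of_rat (q n)) \<longlonglongrightarrow> Abs_two_adic q" .
  have "(\<lambda>n. dist (x n) (of_rat (q n)) + dist (of_rat (q n)) (Abs_two_adic q)) \<longlonglongrightarrow> 0"
    using tendsto_add[OF lim *[THEN tendsto_dist_iff[THEN iffD1]]] by simp
  then have "(\<lambda>n. dist (x n) (Abs_two_adic q)) \<longlonglongrightarrow> 0"
    by (rule tendsto_sandwich[OF _ _ tendsto_const, rotated 2])
       (rule always_eventually, rule allI, rule zero_le_dist dist_triangle)+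
  then have "x \<longlonglongrightarrow> Abs_two_adic q" by (rule tendsto_dist_iff[THEN iffD2])
  then show "convergent x" by (auto simp: convergent_def)
qed


section \<open>2-adic integers, exponential and logarithm\<close>

definition Z2 :: "two_adic set" where
  "Z2 = {x. norm2 x \<le> 1}"

definition dvd_Z2 :: "two_adic \<Rightarrow> two_adic \<Rightarrow> bool" where
  "dvd_Z2 a x \<longleftrightarrow> (\<exists>y\<in>Z2. x = a * y)"

definition omega2 :: "two_adic \<Rightarrow> two_adic" where
  "omega2 x = (THE w. w \<in> {1, -1} \<and> dvd_Z2 4 (x - w))"

definition angle2 :: "two_adic \<Rightarrow> two_adic" where
  "angle2 x = x / omega2 x"

text \<open>
  The two series below converge in the 2-adic topology for the arguments they are applied to:
  the logarithm on \<open>1 + 4 Z2\<close>, with values in \<open>4 Z2\<close>, and the exponential on \<open>4 Z2\<close>.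
\<close>

definition padic_exp :: "two_adic \<Rightarrow> two_adic" where
  "padic_exp x = (\<Sum>k. x ^ k / fact k)"

definition padic_log :: "two_adic \<Rightarrow> two_adic" where
  "padic_log x = (\<Sum>k. (-1) ^ k * (x - 1) ^ Suc k / of_nat (Suc k))"

definition angle2_power :: "two_adic \<Rightarrow> two_adic \<Rightarrow> two_adic" where
  "angle2_power x z = padic_exp (z * padic_log (angle2 x))"

end

theory Submission
  imports Defs
begin

text \<open>
  Write \<open>|x|\<close> for \<open>norm2 x\<close>. Everything rests on one identity: \<open>|y ^ N - 1| = |N| |y - 1|\<close>
  whenever \<open>y \<equiv> 1\<close> modulo 4 (\<open>norm2_power_minus_1\<close>), because the linear term dominates the
  binomial expansion of \<open>(1 + (y - 1)) ^ N\<close>.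

  An odd integer \<open>x\<close> is congruent modulo 4 to exactly one sign \<open>w\<close>. The identity for \<open>y = x\<^sup>2\<close>
  gives \<open>|x ^ (2 * N) - 1| = |2 * N| |x - w|\<close>, and for \<open>2 * N = x ^ n - 1\<close> this reads
  \<open>|x ^ x ^ n - x| = |x ^ n - 1| |x - w|\<close> (\<open>norm2_self_power_minus\<close>). The same tools evaluate
  the first factor: it is \<open>|n| |x - w|\<close> if \<open>n\<close> is even or \<open>w = 1\<close>, and it is \<open>1/2\<close> if \<open>n\<close> is odd
  and \<open>w = -1\<close>. So the congruence modulo \<open>2 ^ e\<close> is a condition on \<open>|x - w|\<close> alone, that is, a
  congruence \<open>x \<equiv> w\<close> modulo a power of 2 (\<open>self_power_cong_iff\<close>): quadratic in \<open>|x - w|\<close>,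
  except for \<open>n\<close> odd and \<open>w = -1\<close>, where it is linear, so that for large \<open>e\<close> just two solutions remain.
  For small \<open>e\<close> these powers divide 4 and all odd \<open>x\<close> are solutions; for large \<open>e\<close> the solutions form
  one residue class near \<open>1\<close> and one near \<open>-1\<close>.

  In the equation over the 2-adic integers put \<open>y = \<langle>x\<rangle>\<close>; it becomes
  \<open>exp (x ^ n * log y) = y\<close>. Since \<open>log (exp s) = s\<close> (\<open>padic_log_exp\<close>), taking logarithms leaves
  \<open>x ^ n * log y = log y\<close>, so \<open>log y = 0\<close> or \<open>x ^ n = 1\<close>. Both force \<open>y = 1\<close> by the basic
  identity. To invert the exponential without composing power
  series, the logarithm is computed as the limit of \<open>(y ^ 2 ^ K - 1) / 2 ^ K\<close>
  (\<open>norm2_log_minus_quotient_le\<close>). For \<open>y = exp s\<close> these quotients are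
  \<open>(exp (2 ^ K * s) - 1) / 2 ^ K\<close>, which tend to \<open>s\<close> because \<open>exp t = 1 + t\<close> up to \<open>O(t\<^sup>2)\<close>.
\<close>

section \<open>The 2-adic norm\<close>

lemma norm2_0 [simp]: "norm2 0 = 0"
  using norm2_of_rat[of 0] by simp

lemma norm2_1 [simp]: "norm2 1 = 1"
  using norm2_of_rat[of 1] by simp

lemma norm2_eq_0_iff [simp]: "norm2 x = 0 \<longleftrightarrow> x = 0"
  using dist_eq_0_iff[of x 0] by (simp add: dist_two_adic_def)

lemma norm2_nonneg [simp]: "0 \<le> norm2 x"
  using zero_le_dist[of x 0] by (simp add: dist_two_adic_def)

lemma norm2_pos_iff [simp]: "0 < norm2 x \<longleftrightarrow> x \<noteq> 0"
  using norm2_nonneg[of x] norm2_eq_0_iff[of x] by linarith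

lemma norm2_minus [simp]: "norm2 (- x) = norm2 x"
  using dist_commute[of x 0] by (simp add: dist_two_adic_def)

lemma norm2_minus_commute: "norm2 (x - y) = norm2 (y - x)"
  using norm2_minus[of "x - y"] by simp

lemma norm2_power: "norm2 (x ^ k) = norm2 x ^ k"
  by (induction k) (simp_all add: norm2_mult)

lemma norm2_divide: "norm2 (x / y) = norm2 x / norm2 y"
proof (cases "y = 0")
  case False
  have "norm2 (x / y) * norm2 y = norm2 x"
    using False by (simp flip: norm2_mult)
  then show ?thesis using False by (simp add: field_simps)
qed simp

lemma norm2_add_le: "norm2 x \<le> B \<Longrightarrow> norm2 y \<le> B \<Longrightarrow> norm2 (x + y) \<le> B"
  using norm2_add_le_max[of x y] by simp

lemma norm2_diff_trans: "norm2 (x - y) \<le> B \<Longrightarrow> norm2 (y - z) \<le> B \<Longrightarrow> norm2 (x - z) \<le> B"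
  using norm2_add_le[of "x - y" B "y - z"] by simp

lemma norm2_sum_le:
  assumes "0 \<le> B" "\<And>i. i \<in> A \<Longrightarrow> norm2 (f i) \<le> B"
  shows "norm2 (sum f A) \<le> B"
  using assms by (induction A rule: infinite_finite_induct) (simp_all add: norm2_add_le)

lemma norm2_add_dominant:
  assumes "norm2 x < norm2 y"
  shows "norm2 (x + y) = norm2 y"
  using assms norm2_add_le_max[of x y] norm2_add_le_max[of "x + y" "- x"]
  by (simp add: max_def split: if_splits)

lemma eqI_norm2:
  assumes "\<And>k. norm2 (x - y) \<le> (1/2) ^ k"
  shows "x = y"
proof -
  have "(\<lambda>k. (1/2::real) ^ k) \<longlonglongrightarrow> 0" by (rule LIMSEQ_power_zero) simp
  then have "norm2 (x - y) \<le> 0"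
    by (rule LIMSEQ_le_const) (use assms in auto)
  then show ?thesis using norm2_nonneg[of "x - y"] by (metis antisym norm2_eq_0_iff right_minus_eq)
qed

lemma norm2_of_int:
  assumes "a \<noteq> 0"
  shows "norm2 (of_int a) = (1/2) ^ multiplicity 2 a"
  using assms norm2_of_rat[of "of_int a"]
  by (simp add: abs2_def val2_def power_int_minus power_one_over inverse_eq_divide)

lemma norm2_of_int_le_iff: "norm2 (of_int a) \<le> (1/2) ^ e \<longleftrightarrow> 2 ^ e dvd a"
proof (cases "a = 0")
  case False
  have "norm2 (of_int a) \<le> (1/2) ^ e \<longleftrightarrow> e \<le> multiplicity 2 a"
    by (simp add: norm2_of_int[OF False] power_decreasing_iff)
  then show ?thesis using False by (simp add: power_dvd_iff_le_multiplicity)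
qed simp

lemma norm2_of_nat_le_1: "norm2 (of_nat m) \<le> 1"
  using norm2_of_int_le_iff[of "int m" 0] by simp

lemma norm2_of_int_odd: "odd a \<Longrightarrow> norm2 (of_int a) = 1"
  using norm2_of_int[of a] by (auto simp: not_dvd_imp_multiplicity_0)

lemma norm2_2 [simp]: "norm2 2 = 1/2"
  using norm2_of_int[of 2] multiplicity_same_power[of "2::int" 1] by simp

lemma norm2_4 [simp]: "norm2 4 = 1/4"
  using norm2_power[of 2 2] by (simp add: power2_eq_square)

lemma norm2_of_nat_ge:
  assumes "m \<ge> 1"
  shows "1 / real m \<le> norm2 (of_nat m)"
proof -
  have "2 ^ multiplicity 2 (int m) \<le> int m"
    using assms by (intro zdvd_imp_le multiplicity_dvd) auto
  then have "2 ^ multiplicity 2 (int m) \<le> real m"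
    by (metis of_int_le_iff of_int_of_nat_eq of_int_power of_int_numeral)
  then have "1 / real m \<le> 1 / 2 ^ multiplicity 2 (int m)"
    using assms by (intro divide_left_mono) auto
  then show ?thesis
    using assms norm2_of_int[of "int m"] by (simp add: power_one_over)
qed

lemma norm2_divide_of_nat_le:
  assumes "m \<ge> 1"
  shows "norm2 (x / of_nat m) \<le> real m * norm2 x"
proof -
  have "norm2 x * 1 \<le> norm2 x * (real m * norm2 (of_nat m))"
    using norm2_of_nat_ge[OF assms] assms by (intro mult_left_mono) (auto simp: field_simps)
  moreover have "norm2 (of_nat m) > 0" using assms by simp
  ultimately show ?thesis by (simp add: norm2_divide field_simps)
qed

lemma norm2_fact_double: "norm2 (fact (2 * m)) = (1/2) ^ m * norm2 (fact m)"
proof (induction m)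
  case (Suc m)
  have "(fact (2 * Suc m) :: two_adic)
      = 2 * of_nat (Suc m) * of_int (2 * int m + 1) * fact (2 * m)"
    by (simp add: algebra_simps)
  then show ?case
    using norm2_of_int_odd[of "2 * int m + 1"] Suc
    by (simp only: norm2_mult fact_Suc) simp
qed simp

text \<open>
  Legendre's formula bounds the 2-adic valuation of \<open>m!\<close> by \<open>m\<close>; halving \<open>m\<close> proves it, since the
  odd factors of \<open>m!\<close> are units. This is what makes the exponential converge on \<open>4 Z2\<close>.
\<close>

lemma norm2_fact_ge: "(1/2) ^ m \<le> norm2 (fact m)"
proof (induction m rule: less_induct)
  case (less m)
  have double: "(1/2) ^ (2 * k) \<le> norm2 (fact (2 * k))" if "k < m \<or> k = 0" for k
  proof -
    have "(1/2) ^ k \<le> norm2 (fact k)" using that less by auto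
    then have "(1/2) ^ k * (1/2) ^ k \<le> (1/2) ^ k * norm2 (fact k)"
      by (intro mult_left_mono) auto
    then show ?thesis by (simp only: norm2_fact_double mult_2[of k, symmetric] power_add[symmetric])
  qed
  show ?case
  proof (cases "even m")
    case True
    then obtain k where m: "m = 2 * k" by (elim evenE)
    then have "k < m \<or> k = 0" by linarith
    then show ?thesis unfolding m by (rule double[unfolded m])
  next
    case False
    then obtain k where m: "m = Suc (2 * k)" by (elim oddE) simp
    have "norm2 (of_nat m) = 1" using norm2_of_int_odd[of "int m"] False by simp
    then have "norm2 (fact m) = norm2 (fact (2 * k))"
      unfolding m by (simp only: fact_Suc norm2_mult)
    moreover have "(1/2::real) ^ m \<le> (1/2) ^ (2 * k)"
      unfolding m by (rule power_decreasing) auto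
    moreover have "(1/2) ^ (2 * k) \<le> norm2 (fact (2 * k))"
      by (rule double) (simp add: m)
    ultimately show ?thesis by (simp only:)
  qed
qed

section \<open>Powers of elements close to 1\<close>

text \<open>
  The factor \<open>|N|\<close> comes from absorption, \<open>j * (N choose j) = N * ((N - 1) choose (j - 1))\<close>, and the
  price \<open>j\<close> bounds \<open>1 / |j|\<close>.
\<close>

lemma norm2_binomial_le:
  assumes "j \<ge> 1"
  shows "norm2 (of_nat (N choose j)) \<le> norm2 (of_nat N) * real j"
proof -
  have "of_nat j * of_nat (N choose j) = (of_nat N * of_nat ((N - 1) choose (j - 1)) :: two_adic)"
    using times_binomial_minus1_eq[of j N] assms by (metis of_nat_mult not_one_le_zero gr0I)
  then have "of_nat (N choose j) = (of_nat N * of_nat ((N - 1) choose (j - 1)) / of_nat j :: two_adic)"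
    using assms by (simp add: field_simps)
  also have "norm2 \<dots> \<le> real j * norm2 (of_nat N * of_nat ((N - 1) choose (j - 1)))"
    by (rule norm2_divide_of_nat_le[OF assms])
  also have "\<dots> \<le> real j * (norm2 (of_nat N) * 1)"
    unfolding norm2_mult by (intro mult_left_mono norm2_of_nat_le_1) auto
  finally show ?thesis by (simp add: mult.commute)
qed

lemma le_four_power: "real i + 2 \<le> 2 * 4 ^ i"
  by (induction i) auto

lemma mult_power_le:
  assumes "0 \<le> r" "r \<le> 1/4" "j \<ge> 2"
  shows "real j * r ^ j \<le> 2 * r\<^sup>2"
proof -
  obtain i where i: "j = 2 + i" using le_Suc_ex[OF assms(3)] by blast
  have "(real i + 2) * r ^ i \<le> (2 * 4 ^ i) * (1/4) ^ i"
    using assms by (intro mult_mono le_four_power power_mono) auto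
  then have "(real i + 2) * r ^ i \<le> 2" by (simp add: power_one_over)
  then have "(real i + 2) * r ^ i * r\<^sup>2 \<le> 2 * r\<^sup>2" by (rule mult_right_mono) simp
  then show ?thesis by (simp add: i power_add power2_eq_square mult_ac add_ac)
qed

text \<open>
  The terms of degree at least 2 in the binomial expansion are at most \<open>2 |N| |y - 1|\<^sup>2\<close>, and
  \<open>2 |y - 1| < 1\<close>, so the linear term alone decides the norm.
\<close>

lemma norm2_power_minus_1:
  assumes "norm2 (y - 1) \<le> 1/4"
  shows "norm2 (y ^ N - 1) = norm2 (of_nat N) * norm2 (y - 1)"
proof (cases "N = 0 \<or> y = 1")
  case False
  define w where "w = y - 1"
  have w: "norm2 w \<le> 1/4" "w \<noteq> 0" and N: "N \<ge> 1" using assms False by (auto simp: w_def)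
  have "y ^ N = (\<Sum>j\<le>N. of_nat (N choose j) * w ^ j)"
    using binomial_ring[of w 1 N] by (simp add: w_def)
  also have "{..N} = insert 0 (insert 1 {2..N})" using N by auto
  finally have expand: "y ^ N - 1 = (\<Sum>j = 2..N. of_nat (N choose j) * w ^ j) + of_nat N * w"
    by (simp add: algebra_simps)
  have pos: "norm2 w > 0" "norm2 (of_nat N) > 0"
    using w N by auto
  have "norm2 (\<Sum>j = 2..N. of_nat (N choose j) * w ^ j) \<le> norm2 (of_nat N) * (2 * norm2 w ^ 2)"
  proof (rule norm2_sum_le)
    fix j assume j: "j \<in> {2..N}"
    have "norm2 (of_nat (N choose j) * w ^ j) \<le> norm2 (of_nat N) * real j * norm2 w ^ j"
      unfolding norm2_mult norm2_power
      using j by (intro mult_right_mono norm2_binomial_le) auto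
    also have "\<dots> \<le> norm2 (of_nat N) * (2 * norm2 w ^ 2)"
      using mult_power_le[of "norm2 w" j] w j by (simp add: mult_left_mono mult.assoc)
    finally show "norm2 (of_nat (N choose j) * w ^ j) \<le> norm2 (of_nat N) * (2 * norm2 w ^ 2)" .
  qed simp
  also have "\<dots> < norm2 (of_nat N) * norm2 w"
    using w pos by (intro mult_strict_left_mono) (auto simp: power2_eq_square)
  finally have "norm2 (y ^ N - 1) = norm2 (of_nat N * w)"
    unfolding expand by (intro norm2_add_dominant) (simp add: norm2_mult)
  then show ?thesis by (simp add: norm2_mult w_def)
qed auto

section \<open>Series\<close>

text \<open>
  Convergence and error bound in one statement: all later work with \<open>padic_exp\<close> and \<open>padic_log\<close> goes
  through finite partial sums. By the ultrametric inequality a tail is as small as its largest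
  term. The geometric bound is required only from \<open>N\<close> on, so that \<open>c\<close> may depend on how many
  initial terms are split off.
\<close>

lemma norm2_suminf_minus_partial_sum_le:
  assumes bound: "\<And>k. k \<ge> N \<Longrightarrow> norm2 (f k) \<le> c * (1/2) ^ k"
  shows "norm2 (suminf f - (\<Sum>k<N. f k)) \<le> c * (1/2) ^ N"
proof -
  have c: "c \<ge> 0"
    using order_trans[OF norm2_nonneg bound[of N]] mult_neg_pos[of c "(1/2) ^ N"] by fastforce
  have tail: "norm2 ((\<Sum>k<m. f k) - (\<Sum>k<n. f k)) \<le> c * (1/2) ^ n" if "N \<le> n" "n \<le> m" for m n
  proof -
    have "(\<Sum>k<m. f k) - (\<Sum>k<n. f k) = (\<Sum>k = n..<m. f k)"
      using sum_diff_nat_ivl[of 0 n m f] that by (simp add: atLeast0LessThan)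
    also have "norm2 \<dots> \<le> c * (1/2) ^ n"
    proof (rule norm2_sum_le)
      fix k assume k: "k \<in> {n..<m}"
      have "norm2 (f k) \<le> c * (1/2) ^ k" using bound k that by simp
      also have "\<dots> \<le> c * (1/2) ^ n"
        using k c by (intro mult_left_mono power_decreasing) auto
      finally show "norm2 (f k) \<le> c * (1/2) ^ n" .
    qed (use c in simp)
    finally show ?thesis .
  qed
  have lim0: "(\<lambda>n. c * (1/2) ^ n) \<longlonglongrightarrow> 0"
    by (rule tendsto_mult_right_zero, rule LIMSEQ_power_zero) simp
  have "Cauchy (\<lambda>n. \<Sum>k<n. f k)"
  proof (rule metric_CauchyI)
    fix r :: real assume "r > 0"
    then have "\<forall>\<^sub>F n in sequentially. c * (1/2) ^ n < r"
      using order_tendstoD(2)[OF lim0] by blast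
    then obtain M where M: "\<And>n. n \<ge> M \<Longrightarrow> c * (1/2) ^ n < r"
      by (auto simp: eventually_sequentially)
    show "\<exists>M. \<forall>m\<ge>M. \<forall>n\<ge>M. dist (\<Sum>k<m. f k) (\<Sum>k<n. f k) < r"
    proof (intro exI[of _ "max M N"] allI impI)
      fix m n assume "max M N \<le> m" "max M N \<le> n"
      then show "dist (\<Sum>k<m. f k) (\<Sum>k<n. f k) < r"
        using tail[of m n] tail[of n m] M[of m] M[of n]
        by (cases "m \<le> n") (auto simp: dist_two_adic_def norm2_minus_commute[of "sum f {..<m}"])
    qed
  qed
  then obtain L where L: "(\<lambda>n. \<Sum>k<n. f k) \<longlonglongrightarrow> L"
    using Cauchy_convergent_iff convergent_def by blast
  then have suminf: "suminf f = L" using sums_unique[of f L] by (simp add: sums_def)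
  have "(\<lambda>n. dist (\<Sum>k<n. f k) (\<Sum>k<N. f k)) \<longlonglongrightarrow> dist L (\<Sum>k<N. f k)"
    by (intro tendsto_dist L tendsto_const)
  then have "dist L (\<Sum>k<N. f k) \<le> c * (1/2) ^ N"
    by (rule LIMSEQ_le_const2) (use tail in \<open>auto simp: dist_two_adic_def intro!: exI[of _ N]\<close>)
  then show ?thesis by (simp add: suminf dist_two_adic_def)
qed

section \<open>The exponential\<close>

lemma norm2_exp_term_le:
  assumes "norm2 s \<le> 1/4"
  shows "norm2 (s ^ k / fact k) \<le> (1/2) ^ k"
proof -
  have "norm2 (s ^ k / fact k) \<le> (1/4) ^ k / (1/2) ^ k"
    unfolding norm2_divide norm2_power
    using assms norm2_fact_ge[of k] by (intro frac_le power_mono) auto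
  then show ?thesis by (simp flip: power_divide)
qed

lemma norm2_exp_partial_sum_le:
  assumes "norm2 s \<le> 1/4"
  shows "norm2 (padic_exp s - (\<Sum>k<N. s ^ k / fact k)) \<le> (1/2) ^ N"
proof -
  have "norm2 (s ^ k / fact k) \<le> 1 * (1/2) ^ k" for k
    using norm2_exp_term_le[OF assms] by simp
  from norm2_suminf_minus_partial_sum_le[OF this] show ?thesis
    unfolding padic_exp_def by simp
qed

lemma norm2_exp_minus_linear_le:
  assumes "norm2 s \<le> 1/4"
  shows "norm2 (padic_exp s - (1 + s)) \<le> 4 * norm2 s ^ 2"
proof -
  have "norm2 (s ^ k / fact k) \<le> (16 * norm2 s ^ 2) * (1/2) ^ k" if k: "k \<ge> 2" for k
  proof -
    obtain i where i: "k = 2 + i" using le_Suc_ex[OF k] by blast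
    have "norm2 (s ^ k / fact k) \<le> norm2 s ^ k / (1/2) ^ k"
      unfolding norm2_divide norm2_power
      by (rule frac_le) (simp_all add: norm2_fact_ge)
    also have "norm2 s ^ k \<le> norm2 s ^ 2 * (1/4) ^ i"
      unfolding i power_add using assms by (intro mult_left_mono power_mono) auto
    also have "norm2 s ^ 2 * (1/4) ^ i / (1/2) ^ k = (16 * norm2 s ^ 2) * (1/2) ^ k"
    proof -
      have "(4::real) ^ i = 2 ^ i * 2 ^ i" by (simp flip: power_mult_distrib)
      then show ?thesis by (simp add: i power_add field_simps power_one_over)
    qed
    finally show ?thesis by (simp add: divide_right_mono)
  qed
  then have "norm2 (padic_exp s - (\<Sum>k<2. s ^ k / fact k)) \<le> (16 * norm2 s ^ 2) * (1/2) ^ 2"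
    unfolding padic_exp_def by (rule norm2_suminf_minus_partial_sum_le)
  then show ?thesis by (simp add: numeral_2_eq_2)
qed

lemma norm2_exp_minus_1_le:
  assumes "norm2 s \<le> 1/4"
  shows "norm2 (padic_exp s - 1) \<le> 1/4"
proof (rule norm2_diff_trans)
  have "4 * norm2 s ^ 2 \<le> 4 * (1/4) ^ 2"
    using assms by (intro mult_left_mono power_mono) auto
  then show "norm2 (padic_exp s - (1 + s)) \<le> 1/4"
    using norm2_exp_minus_linear_le[OF assms] by (simp add: power2_eq_square)
qed (use assms in simp)

lemma norm2_le_1_if_near_1:
  assumes "norm2 (y - 1) \<le> 1/4"
  shows "norm2 y \<le> 1"
  using norm2_add_le[of "y - 1" 1 1] assms by simp

lemma padic_exp_0 [simp]: "padic_exp 0 = 1"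
  using norm2_exp_minus_linear_le[of 0] norm2_nonneg[of "padic_exp 0 - 1"]
  by (metis add.right_neutral divide_nonneg_nonneg antisym mult_zero_right norm2_0 norm2_eq_0_iff
      right_minus_eq zero_le_numeral zero_le_one zero_power2)

text \<open>
  The square \<open>i, j < N\<close> of products of terms contains the triangle \<open>i + j < N\<close>, whose sum is the
  partial sum for \<open>s + t\<close>; what is left over has \<open>i + j \<ge> N\<close> and hence norm at most \<open>2 ^ -N\<close>.
\<close>

lemma padic_exp_add:
  assumes s: "norm2 s \<le> 1/4" and t: "norm2 t \<le> 1/4"
  shows "padic_exp (s + t) = padic_exp s * padic_exp t"
proof (rule eqI_norm2)
  fix N
  \<comment> \<open>Partial sums, and the terms of their product.\<close>
  define E where "E = (\<lambda>x::two_adic. \<Sum>k<N. x ^ k / fact k)"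
  define T where "T = (\<lambda>(i, j). s ^ i / fact i * (t ^ j / fact j))"
  have st: "norm2 (s + t) \<le> 1/4" using s t by (rule norm2_add_le)
  have near: "norm2 (padic_exp x - E x) \<le> (1/2) ^ N" if "norm2 x \<le> 1/4" for x
    unfolding E_def by (rule norm2_exp_partial_sum_le[OF that])
  have E1: "norm2 (E x) \<le> 1" if "norm2 x \<le> 1/4" for x
    unfolding E_def by (rule norm2_sum_le) (auto intro!: order_trans[OF norm2_exp_term_le[OF that]] power_le_one)
  have "(s + t) ^ k / fact k = (\<Sum>i\<le>k. T (i, k - i))" for k
    unfolding binomial_ring sum_divide_distrib
    by (intro sum.cong) (auto simp: T_def binomial_fact)
  then have Est: "E (s + t) = (\<Sum>(i, j)\<in>{(i, j). i + j < N}. T (i, j))"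
    unfolding E_def by (simp only: sum.triangle_reindex)
  have "E s * E t = sum T ({..<N} \<times> {..<N})"
    by (simp add: E_def T_def sum_product sum.cartesian_product)
  moreover have "E (s + t) = sum T {(i, j). i + j < N}" unfolding Est by simp
  moreover have "{(i, j). i + j < N} \<subseteq> {..<N} \<times> {..<N}" by auto
  ultimately have "E s * E t - E (s + t) = sum T ({..<N} \<times> {..<N} - {(i, j). i + j < N})"
    by (simp add: sum_diff)
  also have "norm2 \<dots> \<le> (1/2) ^ N"
  proof (rule norm2_sum_le)
    fix p assume "p \<in> {..<N} \<times> {..<N} - {(i, j). i + j < N}"
    then obtain i j where p: "p = (i, j)" "i + j \<ge> N" by auto
    have "norm2 (T p) \<le> (1/2) ^ i * (1/2) ^ j"
      unfolding p T_def prod.case norm2_mult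
      by (intro mult_mono norm2_exp_term_le s t) auto
    also have "\<dots> \<le> (1/2) ^ N"
      unfolding power_add[symmetric] using p by (intro power_decreasing) auto
    finally show "norm2 (T p) \<le> (1/2) ^ N" .
  qed simp
  finally have "norm2 (E (s + t) - E s * E t) \<le> (1/2) ^ N"
    by (simp add: norm2_minus_commute)
  then have 1: "norm2 (padic_exp (s + t) - E s * E t) \<le> (1/2) ^ N"
    using near[OF st] norm2_diff_trans by blast
  have "norm2 (E s * (E t - padic_exp t)) \<le> 1 * (1/2) ^ N"
    unfolding norm2_mult using E1[OF s] near[OF t]
    by (intro mult_mono) (auto simp: norm2_minus_commute)
  then have 2: "norm2 (E s * E t - E s * padic_exp t) \<le> (1/2) ^ N"
    by (simp add: algebra_simps)
  have "norm2 ((E s - padic_exp s) * padic_exp t) \<le> (1/2) ^ N * 1"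
    unfolding norm2_mult using norm2_le_1_if_near_1[OF norm2_exp_minus_1_le[OF t]] near[OF s]
    by (intro mult_mono) (auto simp: norm2_minus_commute)
  then have 3: "norm2 (E s * padic_exp t - padic_exp s * padic_exp t) \<le> (1/2) ^ N"
    by (simp add: algebra_simps)
  show "norm2 (padic_exp (s + t) - padic_exp s * padic_exp t) \<le> (1/2) ^ N"
    using norm2_diff_trans[OF norm2_diff_trans[OF 1 2] 3] .
qed

lemma norm2_of_nat_mult_le: "norm2 s \<le> B \<Longrightarrow> norm2 (of_nat m * s) \<le> B"
  using mult_mono[OF norm2_of_nat_le_1[of m], of "norm2 s" B]
  by (simp add: norm2_mult)

lemma padic_exp_of_nat_mult:
  assumes "norm2 s \<le> 1/4"
  shows "padic_exp (of_nat m * s) = padic_exp s ^ m"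
proof (induction m)
  case (Suc m)
  then show ?case
    using padic_exp_add[OF assms norm2_of_nat_mult_le[OF assms, of m]] by (simp add: algebra_simps)
qed simp

section \<open>The logarithm\<close>

lemma norm2_log_term_le:
  assumes "norm2 w \<le> 1/4"
  shows "norm2 ((-1) ^ k * w ^ Suc k / of_nat (Suc k)) \<le> 1/4 * (1/2) ^ k"
proof -
  have "norm2 ((-1) ^ k * w ^ Suc k / of_nat (Suc k)) \<le> real (Suc k) * norm2 ((-1) ^ k * w ^ Suc k)"
    by (rule norm2_divide_of_nat_le) simp
  also have "\<dots> = real (Suc k) * norm2 w ^ Suc k"
    by (simp add: norm2_mult norm2_power)
  also have "\<dots> \<le> 2 ^ k * (1/4) ^ Suc k"
  proof (intro mult_mono power_mono assms)
    have "Suc k \<le> 2 ^ k" by (simp add: Suc_leI)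
    then show "real (Suc k) \<le> 2 ^ k" by (metis of_nat_le_iff of_nat_numeral of_nat_power)
  qed auto
  also have "\<dots> = 1/4 * (1/2) ^ k"
    by (simp flip: power_mult_distrib)
  finally show ?thesis .
qed

lemma norm2_log_le:
  assumes "norm2 (y - 1) \<le> 1/4"
  shows "norm2 (padic_log y) \<le> 1/4"
  using norm2_suminf_minus_partial_sum_le[of 0, OF norm2_log_term_le[OF assms]]
  by (simp add: padic_log_def)

text \<open>
  The coefficient of \<open>w ^ (j + 1)\<close> in \<open>((1 + w) ^ N - 1) / N\<close> is \<open>((N - 1) choose j) / (j + 1)\<close>; if \<open>N\<close>
  is 2-adically small it is close to the coefficient \<open>(-1) ^ j / (j + 1)\<close> of the logarithm.
  Pascal's rule and the bound on \<open>N choose (j + 1)\<close> give this by induction.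
\<close>

lemma norm2_binomial_alternating_le:
  assumes "N \<ge> 1"
  shows "norm2 (of_nat ((N - 1) choose j) - (-1) ^ j) \<le> norm2 (of_nat N) * real j"
proof (induction j)
  case (Suc j)
  have "((N - 1) choose Suc j) + ((N - 1) choose j) = N choose Suc j"
    using assms by (cases N) auto
  then have eq: "of_nat ((N - 1) choose Suc j) - (-1) ^ Suc j
      = of_nat (N choose Suc j) + - (of_nat ((N - 1) choose j) - (-1) ^ j :: two_adic)"
    by (simp add: algebra_simps flip: of_nat_add)
  show ?case
    unfolding eq
  proof (rule norm2_add_le)
    show "norm2 (- (of_nat ((N - 1) choose j) - (-1) ^ j)) \<le> norm2 (of_nat N) * real (Suc j)"
      using Suc unfolding norm2_minus by (rule order_trans) (simp add: mult_left_mono)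
  qed (simp add: norm2_binomial_le del: of_nat_Suc binomial_Suc_Suc)
qed simp

text \<open>
  This replaces the functional equation of the logarithm. Compare the first \<open>2 ^ K\<close> terms of both
  expansions in \<open>y - 1\<close>: the quotient is a polynomial of that degree, and the tail of the logarithm
  is smaller than \<open>2 ^ -K\<close>.
\<close>

lemma norm2_log_minus_quotient_le:
  assumes "norm2 (y - 1) \<le> 1/4"
  shows "norm2 (padic_log y - (y ^ 2 ^ K - 1) / 2 ^ K) \<le> (1/2) ^ K"
proof (rule norm2_diff_trans)
  define w where "w = y - 1"
  define N :: nat where "N = 2 ^ K"
  have w: "norm2 w \<le> 1/4" and N: "N \<ge> 1" using assms by (auto simp: w_def N_def)
  have N_two_adic: "of_nat N = (2 ^ K :: two_adic)" by (simp add: N_def)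
  have "norm2 (padic_log y - (\<Sum>k<N. (-1) ^ k * w ^ Suc k / of_nat (Suc k))) \<le> 1/4 * (1/2) ^ N"
    unfolding padic_log_def w_def
    by (rule norm2_suminf_minus_partial_sum_le, rule norm2_log_term_le, rule assms)
  also have "\<dots> \<le> 1 * (1/2) ^ K"
    by (intro mult_mono power_decreasing) (auto simp: N_def less_imp_le)
  finally show "norm2 (padic_log y - (\<Sum>k<N. (-1) ^ k * w ^ Suc k / of_nat (Suc k))) \<le> (1/2) ^ K"
    by simp
  have "y ^ N = (\<Sum>j\<le>N. of_nat (N choose j) * w ^ j)"
    using binomial_ring[of w 1 N] by (simp add: w_def)
  also have "\<dots> = 1 + (\<Sum>k<N. of_nat (N choose Suc k) * w ^ Suc k)"
    by (subst lessThan_Suc_atMost[symmetric], subst sum.lessThan_Suc_shift) simp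
  finally have "(y ^ N - 1) / of_nat N
      = (\<Sum>k<N. of_nat (N choose Suc k) * w ^ Suc k / of_nat N)"
    by (simp add: sum_divide_distrib)
  also have "\<dots> = (\<Sum>k<N. of_nat ((N - 1) choose k) * w ^ Suc k / of_nat (Suc k))"
  proof (intro sum.cong refl)
    fix k
    have "of_nat (Suc k) * of_nat (N choose Suc k) = (of_nat N * of_nat ((N - 1) choose k) :: two_adic)"
      using times_binomial_minus1_eq[of "Suc k" N] by (metis of_nat_mult diff_Suc_1 zero_less_Suc)
    then show "of_nat (N choose Suc k) * w ^ Suc k / of_nat N
        = of_nat ((N - 1) choose k) * w ^ Suc k / of_nat (Suc k)"
      using N by (simp add: frac_eq_eq mult.commute del: of_nat_Suc binomial_Suc_Suc)
  qed
  finally have diff: "(\<Sum>k<N. (-1) ^ k * w ^ Suc k / of_nat (Suc k)) - (y ^ 2 ^ K - 1) / 2 ^ K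
      = (\<Sum>k<N. - (of_nat ((N - 1) choose k) - (-1) ^ k) * w ^ Suc k / of_nat (Suc k))"
    by (simp add: N_two_adic N_def[symmetric] algebra_simps diff_divide_distrib flip: sum_subtractf)
  show "norm2 ((\<Sum>k<N. (-1) ^ k * w ^ Suc k / of_nat (Suc k)) - (y ^ 2 ^ K - 1) / 2 ^ K) \<le> (1/2) ^ K"
    unfolding diff
  proof (rule norm2_sum_le)
    fix k
    let ?d = "of_nat ((N - 1) choose k) - (-1) ^ k :: two_adic"
    have "norm2 (- ?d * w ^ Suc k / of_nat (Suc k)) \<le> real (Suc k) * norm2 (- ?d * w ^ Suc k)"
      by (rule norm2_divide_of_nat_le) simp
    also have "\<dots> = real (Suc k) * (norm2 ?d * norm2 w ^ Suc k)"
      by (simp only: norm2_mult norm2_power norm2_minus)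
    also have "\<dots> \<le> 2 ^ Suc k * (((1/2) ^ K * 2 ^ Suc k) * (1/4) ^ Suc k)"
    proof (intro mult_mono power_mono w)
      have le: "real (Suc k) \<le> 2 ^ Suc k"
        by (metis of_nat_less_two_power less_imp_le)
      then show "real (Suc k) \<le> 2 ^ Suc k" .
      have "norm2 (of_nat N) = (1/2) ^ K" unfolding N_two_adic by (simp add: norm2_power)
      then have "norm2 ?d \<le> (1/2) ^ K * real k"
        using norm2_binomial_alternating_le[OF N, of k] by simp
      also have "\<dots> \<le> (1/2) ^ K * 2 ^ Suc k"
        using le by (intro mult_left_mono) auto
      finally show "norm2 ?d \<le> (1/2) ^ K * 2 ^ Suc k" .
    qed auto
    also have "\<dots> = (1/2) ^ K * (2 * 2 * (1/4)) ^ Suc k"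
      unfolding power_mult_distrib by (simp only: mult_ac)
    finally show "norm2 (- ?d * w ^ Suc k / of_nat (Suc k)) \<le> (1/2) ^ K" by simp
  qed simp
qed

text \<open>
  By \<open>padic_exp_of_nat_mult\<close> the quotients that approximate the logarithm are
  \<open>(exp t - 1) / 2 ^ K\<close> with \<open>t = 2 ^ K * s\<close>. Dividing by \<open>2 ^ K\<close> costs one factor \<open>2 ^ K\<close>,
  but the quadratic error of \<open>exp t\<close> gains two.
\<close>

lemma padic_log_exp:
  assumes s: "norm2 s \<le> 1/4"
  shows "padic_log (padic_exp s) = s"
proof (rule eqI_norm2)
  fix K
  define t where "t = of_nat (2 ^ K) * s"
  have t: "norm2 t \<le> 1/4" unfolding t_def by (rule norm2_of_nat_mult_le[OF s])
  have nt: "norm2 t = (1/2) ^ K * norm2 s" by (simp add: t_def norm2_mult norm2_power)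
  have "(padic_exp s ^ 2 ^ K - 1) / 2 ^ K - s = (padic_exp t - (1 + t)) / 2 ^ K"
    using padic_exp_of_nat_mult[OF s, of "2 ^ K"] by (simp add: t_def field_simps)
  also have "norm2 \<dots> \<le> (4 * norm2 t ^ 2) / (1/2) ^ K"
    unfolding norm2_divide norm2_power norm2_2
    by (intro divide_right_mono norm2_exp_minus_linear_le t) simp
  also have "\<dots> = (1/2) ^ K * (4 * norm2 s ^ 2)"
    by (simp add: nt power2_eq_square field_simps)
  also have "\<dots> \<le> (1/2) ^ K * (4 * (1/4) ^ 2)"
    using s by (intro mult_left_mono power_mono) auto
  also have "\<dots> \<le> (1/2) ^ K" by (simp add: power2_eq_square)
  finally show "norm2 (padic_log (padic_exp s) - s) \<le> (1/2) ^ K"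
    using norm2_diff_trans norm2_log_minus_quotient_le[OF norm2_exp_minus_1_le[OF s]] by blast
qed

text \<open>
  All the quotients that approximate the logarithm have the same norm \<open>|y - 1|\<close>.
\<close>

lemma eq_1_if_log_eq_0:
  assumes y: "norm2 (y - 1) \<le> 1/4" and "padic_log y = 0"
  shows "y = 1"
proof (rule eqI_norm2)
  fix K
  have "norm2 ((y ^ 2 ^ K - 1) / 2 ^ K) = norm2 (y - 1)"
    using norm2_power_minus_1[OF y, of "2 ^ K"] by (simp add: norm2_divide norm2_power)
  then show "norm2 (y - 1) \<le> (1/2) ^ K"
    using norm2_log_minus_quotient_le[OF y, of K] assms(2) by simp
qed

lemma padic_log_1 [simp]: "padic_log 1 = 0"
  by (simp add: padic_log_def)

section \<open>Units\<close>

lemma dvd_Z2_iff_norm2: "c \<noteq> 0 \<Longrightarrow> dvd_Z2 c x \<longleftrightarrow> norm2 x \<le> norm2 c"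
proof
  assume "c \<noteq> 0" "norm2 x \<le> norm2 c"
  then show "dvd_Z2 c x"
    unfolding dvd_Z2_def Z2_def
    by (intro bexI[of _ "x / c"]) (auto simp: norm2_divide divide_le_eq_1_pos)
next
  assume "dvd_Z2 c x"
  then show "norm2 x \<le> norm2 c"
    by (auto simp: dvd_Z2_def Z2_def norm2_mult mult_left_le)
qed

lemma odd_near_sign:
  fixes a :: int
  assumes "odd a" "odd b"
  shows "4 dvd a - b \<or> 4 dvd a + b"
  using assms by presburger

text \<open>
  This makes \<open>omega2\<close> well defined. A rational number \<open>a / b\<close> close to a unit has \<open>a\<close> and \<open>b\<close> both odd,
  and then 4 divides \<open>a - b\<close> or \<open>a + b\<close>.
\<close>

lemma unit_near_sign:
  assumes x: "x \<in> Z2" "\<not> dvd_Z2 2 x"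
  obtains w where "w \<in> {1, -1}" "norm2 (x - w) \<le> 1/4"
proof -
  obtain q where q: "norm2 (x - of_rat q) < 1/4"
    using two_adic_rat_dense[of "1/4" x] by (auto simp: dist_two_adic_def)
  obtain a b where ab: "quotient_of q = (a, b)" by fastforce
  have b: "b > 0" "coprime a b" "q = of_int a / of_int b"
    using quotient_of_denom_pos[OF ab] quotient_of_coprime[OF ab] quotient_of_div[OF ab] by auto
  have nx: "norm2 x \<le> 1" "1/2 < norm2 x"
    using x dvd_Z2_iff_norm2[of 2 x] by (auto simp: Z2_def)
  have "norm2 (of_rat q) \<le> 1"
    using norm2_add_le[of "of_rat q - x" 1 x] nx q by (simp add: norm2_minus_commute[of "of_rat q"])
  then have le: "norm2 (of_int a) \<le> norm2 (of_int b)"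
    using b by (simp add: of_rat_divide norm2_divide divide_le_eq_1_pos)
  have "1/2 < norm2 (of_rat q)"
    using norm2_add_le[of "x - of_rat q" "1/2" "of_rat q"] nx q by fastforce
  then have ge: "norm2 (of_int b) < 2 * norm2 (of_int a)"
    using b by (simp add: of_rat_divide norm2_divide field_simps)
  have half: "norm2 (of_int c) \<le> 1/2 \<longleftrightarrow> even c" for c
    using norm2_of_int_le_iff[of c 1] by simp
  have "odd b"
    using b(2) le half[of b] norm2_of_int_odd[of a] by fastforce
  moreover from this have "odd a"
    using ge half[of a] norm2_of_int_odd[of b] by fastforce
  ultimately consider w where "w \<in> {1, -1}" "4 dvd a - w * b"
    using odd_near_sign[of a b] by (metis (no_types) insertI1 insertI2 mult_1 mult_minus1 diff_minus_eq_add)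
  then show thesis
  proof cases
    case (1 w)
    have "of_rat q - of_int w = (of_int (a - w * b) / of_int b :: two_adic)"
      using b(1) unfolding b(3) of_rat_divide by (simp add: field_simps)
    moreover have "norm2 (of_int (a - w * b)) \<le> 1/4"
      using norm2_of_int_le_iff[of "a - w * b" 2] 1 by (simp add: power2_eq_square)
    ultimately have "norm2 (of_rat q - of_int w) \<le> 1/4"
      using norm2_of_int_odd[OF \<open>odd b\<close>] by (simp add: norm2_divide)
    then have "norm2 (x - of_int w) \<le> 1/4"
      using norm2_diff_trans[OF less_imp_le[OF q]] by blast
    moreover have "of_int w \<in> {1, -1 :: two_adic}" using 1 by auto
    ultimately show thesis using that by blast
  qed
qed

lemma omega2_eq:
  assumes "w \<in> {1, -1}" "norm2 (x - w) \<le> 1/4"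
  shows "omega2 x = w"
  unfolding omega2_def
proof (rule the_equality)
  show "w \<in> {1, -1} \<and> dvd_Z2 4 (x - w)" using assms by (simp add: dvd_Z2_iff_norm2)
next
  fix v assume v: "v \<in> {1, -1} \<and> dvd_Z2 4 (x - v)"
  then have "norm2 (v - w) \<le> 1/4"
    using norm2_diff_trans[of v x "1/4" w] assms
    by (simp add: dvd_Z2_iff_norm2 norm2_minus_commute[of v])
  moreover have "norm2 (-2) = 1/2" by (simp only: norm2_minus norm2_2)
  ultimately show "v = w" using v assms by auto
qed

text \<open>
  Taking logarithms in the equation leaves \<open>log y = 0\<close> or \<open>x ^ n = 1\<close>, where \<open>y = \<langle>x\<rangle>\<close>. In the
  second case the exponent is doubled to remove the sign: \<open>y ^ (2 * n) = 1\<close>.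
\<close>

lemma unit_solutions:
  assumes "n \<ge> 1"
  shows "{x \<in> Z2. \<not> dvd_Z2 2 x \<and> omega2 x * angle2_power x (x ^ n) = x} = {1, -1}"
proof (intro Set.equalityI subsetI)
  fix x assume "x \<in> {x \<in> Z2. \<not> dvd_Z2 2 x \<and> omega2 x * angle2_power x (x ^ n) = x}"
  then have x: "x \<in> Z2" "\<not> dvd_Z2 2 x" and eq: "omega2 x * angle2_power x (x ^ n) = x" by auto
  obtain w where w: "w \<in> {1, -1}" "norm2 (x - w) \<le> 1/4" using unit_near_sign[OF x] .
  define y where "y = x / w"
  have om: "omega2 x = w" and ww: "w * w = 1" "w \<noteq> 0" using omega2_eq w by auto
  have "norm2 w = 1" using w by auto
  moreover have "y - 1 = (x - w) / w" using ww by (simp add: y_def field_simps)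
  ultimately have y: "norm2 (y - 1) \<le> 1/4" using w(2) by (simp add: norm2_divide)
  define s where "s = x ^ n * padic_log y"
  have "norm2 s \<le> 1 ^ n * (1/4)"
    unfolding s_def norm2_mult norm2_power
    using x(1) norm2_log_le[OF y] by (intro mult_mono power_mono) (auto simp: Z2_def)
  then have s: "norm2 s \<le> 1/4" by simp
  have "w * padic_exp s = x" using eq by (simp add: om angle2_power_def angle2_def s_def y_def)
  then have "padic_exp s = y" using ww by (simp add: y_def field_simps)
  then have "padic_log y = x ^ n * padic_log y" using padic_log_exp[OF s] by (simp add: s_def)
  then consider "padic_log y = 0" | "x ^ n = 1" by auto
  then have "y = 1"
  proof cases
    case 2
    have "y ^ (2 * n) = (x ^ n)\<^sup>2 / (w * w) ^ n"
      by (simp add: y_def power_divide power_mult power_mult_distrib power2_eq_square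
          power_mult[symmetric] mult_2 power_add)
    then have "y ^ (2 * n) - 1 = 0" using 2 ww by simp
    then have "norm2 (of_nat (2 * n)) * norm2 (y - 1) = 0"
      using norm2_power_minus_1[OF y, of "2 * n"] by simp
    then show ?thesis using assms by simp
  qed (use eq_1_if_log_eq_0 y in blast)
  then show "x \<in> {1, -1}" using w(1) ww by (simp add: y_def)
next
  fix x :: two_adic assume x: "x \<in> {1, -1}"
  then have "omega2 x = x" "norm2 x = 1" "x \<noteq> 0" by (auto intro: omega2_eq)
  then show "x \<in> {x \<in> Z2. \<not> dvd_Z2 2 x \<and> omega2 x * angle2_power x (x ^ n) = x}"
    by (simp add: Z2_def dvd_Z2_iff_norm2 angle2_power_def angle2_def)
qed

section \<open>Self-power congruences modulo powers of 2\<close>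

lemma norm2_of_nat:
  assumes "m \<noteq> 0"
  shows "norm2 (of_nat m) = (1/2) ^ multiplicity 2 m"
proof -
  define v where "v = multiplicity 2 m"
  have "2 ^ v dvd m" "\<not> 2 ^ Suc v dvd m"
    using assms by (auto simp: v_def power_dvd_iff_le_multiplicity simp del: power_Suc
        intro: multiplicity_dvd)
  then have "2 ^ v dvd int m" "\<not> 2 ^ Suc v dvd int m"
    by (metis int_dvd_int_iff of_nat_numeral of_nat_power)+
  then have "multiplicity 2 (int m) = v" by (rule multiplicity_eqI)
  then show ?thesis using assms norm2_of_int[of "int m"] by (simp add: v_def)
qed

lemma norm2_add_sign:
  assumes "w \<in> {1, -1}" "norm2 (x - w) \<le> 1/4"
  shows "norm2 (x + w) = 1/2"
proof -
  have "norm2 (2 * w) = 1/2" using assms(1) by (auto simp: norm2_mult)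
  then show ?thesis
    using norm2_add_dominant[of "x - w" "2 * w"] assms(2) by (simp add: algebra_simps)
qed

text \<open>
  Squaring removes the sign and brings \<open>x\<close> close to 1, at the cost of the factor
  \<open>|x + w| = 1/2\<close>, which turns \<open>|N|\<close> into \<open>|2 * N|\<close>.
\<close>

lemma norm2_even_power_minus_1:
  assumes w: "w \<in> {1, -1}" and x: "norm2 (x - w) \<le> 1/4"
  shows "norm2 (x ^ (2 * N) - 1) = norm2 (of_nat (2 * N)) * norm2 (x - w)"
proof -
  have "x\<^sup>2 - 1 = (x - w) * (x + w)"
    using w by (auto simp: algebra_simps power2_eq_square)
  then have sq: "norm2 (x\<^sup>2 - 1) = norm2 (x - w) / 2"
    using norm2_add_sign[OF w x] by (simp add: norm2_mult)
  then have "norm2 (x\<^sup>2 - 1) \<le> 1/4" using x norm2_nonneg[of "x - w"] by linarith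
  from norm2_power_minus_1[OF this, of N] show ?thesis
    by (simp add: sq power_mult norm2_mult)
qed

text \<open>
  Cancelling the unit \<open>x\<close> leaves \<open>x ^ (x ^ n - 1) - 1\<close>, and the exponent \<open>x ^ n - 1\<close> is even.
\<close>

lemma norm2_self_power_minus:
  fixes x :: nat
  assumes "odd x" and w: "w \<in> {1, -1}" "norm2 (of_nat x - w) \<le> 1/4"
  shows "norm2 (of_nat (x ^ x ^ n) - of_nat x)
    = norm2 (of_nat (x ^ n) - 1) * norm2 (of_nat x - w)"
proof -
  have "odd (x ^ n)" using assms by simp
  then obtain N where N: "x ^ n = 2 * N + 1" by (elim oddE)
  have "norm2 (of_nat x) = 1" using norm2_of_int_odd[of "int x"] assms by simp
  moreover have "of_nat (x ^ x ^ n) - of_nat x = of_nat x * (of_nat x ^ (2 * N) - 1 :: two_adic)"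
    by (simp add: N algebra_simps)
  moreover have "of_nat (x ^ n) - 1 = (of_nat (2 * N) :: two_adic)" unfolding N by simp
  ultimately show ?thesis
    using norm2_even_power_minus_1[OF w, of N] by (simp add: norm2_mult)
qed

lemma norm2_power_minus_1_sign:
  assumes w: "w \<in> {1, -1}" "norm2 (x - w) \<le> 1/4" and "even n \<or> w = 1"
  shows "norm2 (x ^ n - 1) = norm2 (of_nat n) * norm2 (x - w)"
  using assms(3)
proof
  assume "even n"
  then obtain h where "n = 2 * h" by (elim evenE)
  then show ?thesis using norm2_even_power_minus_1[OF w, of h] by simp
qed (use norm2_power_minus_1 w in auto)

text \<open>
  Here \<open>x ^ n\<close> is close to \<open>-1\<close>, hence at distance exactly \<open>|2|\<close> from 1.
\<close>

lemma norm2_odd_power_minus_1: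
  assumes x: "norm2 (x + 1) \<le> 1/4" and "odd n"
  shows "norm2 (x ^ n - 1) = 1/2"
proof -
  have near: "norm2 (- x - 1) \<le> 1/4" using x norm2_minus[of "x + 1"] by simp
  have "norm2 ((- x) ^ n - 1) \<le> 1/4"
    unfolding norm2_power_minus_1[OF near] by (rule norm2_of_nat_mult_le[of _ _ n, unfolded norm2_mult, OF near])
  moreover have "(- x) ^ n - 1 = - (x ^ n - (-1))" using assms by simp
  ultimately have "norm2 (x ^ n - (-1)) \<le> 1/4" by (simp only: norm2_minus)
  then show ?thesis using norm2_add_sign[of "-1" "x ^ n"] by simp
qed

text \<open>
  For a valuation \<open>m\<close> of \<open>a\<close> the inequality is \<open>e \<le> v + 2 * m\<close>. The truncated subtraction makes the
  right-hand side trivially true for \<open>e \<le> v\<close>, as it should be.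
\<close>

lemma scaled_norm2_square_le_iff:
  "(1/2) ^ v * norm2 (of_int a) ^ 2 \<le> (1/2) ^ e \<longleftrightarrow> 2 ^ ((e - v + 1) div 2) dvd a"
proof (cases "a = 0")
  case False
  have "(1/2) ^ v * norm2 (of_int a) ^ 2 = (1/2) ^ (v + multiplicity 2 a * 2)"
    unfolding norm2_of_int[OF False] by (simp only: power_add power_mult)
  then have "(1/2) ^ v * norm2 (of_int a) ^ 2 \<le> (1/2) ^ e \<longleftrightarrow> e \<le> v + multiplicity 2 a * 2"
    by (simp add: power_decreasing_iff)
  also have "\<dots> \<longleftrightarrow> (e - v + 1) div 2 \<le> multiplicity 2 a" by linarith
  finally show ?thesis using False by (simp add: power_dvd_iff_le_multiplicity)
qed simp

text \<open>
  Exactly one of the two premises \<open>x \<equiv> 1\<close> and \<open>x \<equiv> -1\<close> modulo 4 holds for odd \<open>x\<close>, so the right-hand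
  side is a case distinction. Its conclusions have the same shape for both signs, which lets both
  parities of \<open>n\<close> share the counting.
\<close>

lemma self_power_cong_iff:
  fixes x n e :: nat
  assumes "n \<ge> 1" "e \<ge> 1" "odd x"
    and a: "a = (e - multiplicity 2 n + 1) div 2"
    and b: "b = (if even n then a else e - 1)"
  shows "[x ^ x ^ n = x] (mod 2 ^ e) \<longleftrightarrow>
    (4 dvd int x - 1 \<longrightarrow> 2 ^ a dvd int x - 1) \<and> (4 dvd int x + 1 \<longrightarrow> 2 ^ b dvd int x + 1)"
proof -
  define X :: two_adic where "X = of_nat x"
  have "[x ^ x ^ n = x] (mod 2 ^ e) \<longleftrightarrow> 2 ^ e dvd int (x ^ x ^ n) - int x"
    by (simp only: cong_int_iff[symmetric] cong_iff_dvd_diff of_nat_power of_nat_numeral)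
  also have "\<dots> \<longleftrightarrow> norm2 (of_nat (x ^ x ^ n) - X) \<le> (1/2) ^ e"
    using norm2_of_int_le_iff[of "int (x ^ x ^ n) - int x" e] by (simp add: X_def)
  finally have cong: "[x ^ x ^ n = x] (mod 2 ^ e) \<longleftrightarrow> norm2 (of_nat (x ^ x ^ n) - X) \<le> (1/2) ^ e" .
  have near: "norm2 (X - of_int u) \<le> 1/4 \<longleftrightarrow> 4 dvd int x - u" for u
    using norm2_of_int_le_iff[of "int x - u" 2] by (simp add: X_def power2_eq_square)
  have nn: "norm2 (of_nat n) = (1/2) ^ multiplicity 2 n" using assms by (simp add: norm2_of_nat)
  have quadratic: "[x ^ x ^ n = x] (mod 2 ^ e) \<longleftrightarrow> 2 ^ a dvd int x - u"
    if u: "u \<in> {1, -1}" "4 dvd int x - u" "even n \<or> u = 1" for u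
  proof -
    have w: "of_int u \<in> {1, -1 :: two_adic}" "norm2 (X - of_int u) \<le> 1/4"
      using u near by auto
    have "norm2 (of_nat (x ^ x ^ n) - X) = norm2 (X ^ n - 1) * norm2 (X - of_int u)"
      using norm2_self_power_minus[OF \<open>odd x\<close> w(1)] w(2) by (simp add: X_def)
    also have "\<dots> = (1/2) ^ multiplicity 2 n * norm2 (of_int (int x - u)) ^ 2"
      using norm2_power_minus_1_sign[OF w, of n] u
      by (auto simp: nn X_def power2_eq_square)
    finally show ?thesis unfolding cong a by (simp only: scaled_norm2_square_le_iff)
  qed
  have linear: "[x ^ x ^ n = x] (mod 2 ^ e) \<longleftrightarrow> 2 ^ (e - 1) dvd int x + 1"
    if "4 dvd int x + 1" "odd n"
  proof -
    have w: "norm2 (X + 1) \<le> 1/4" using near[of "-1"] that by simp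
    have "norm2 (of_nat (x ^ x ^ n) - X) = norm2 (of_int (int x + 1)) / 2"
      using norm2_self_power_minus[OF \<open>odd x\<close>, of "-1" n] w norm2_odd_power_minus_1[OF w \<open>odd n\<close>]
      by (simp add: X_def)
    moreover have "(1/2::real) ^ e = (1/2) ^ (e - 1) / 2"
      using assms by (cases e) auto
    ultimately have "norm2 (of_nat (x ^ x ^ n) - X) \<le> (1/2) ^ e
        \<longleftrightarrow> norm2 (of_int (int x + 1)) \<le> (1/2) ^ (e - 1)" by linarith
    then show ?thesis unfolding cong norm2_of_int_le_iff .
  qed
  have "4 dvd int x - 1 \<and> \<not> 4 dvd int x + 1 \<or> 4 dvd int x + 1 \<and> \<not> 4 dvd int x - 1"
    using \<open>odd x\<close> by presburger
  then show ?thesis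
    using quadratic[of 1] quadratic[of "-1"] linear by (auto simp: b)
qed

section \<open>Counting\<close>

text \<open>
  The solutions are \<open>M * k + r + 1\<close> for \<open>k < K\<close>: subtracting 1 turns \<open>{1..M * K}\<close> into the range
  \<open>{0..<M * K}\<close>, on which division by \<open>M\<close> with remainder works.
\<close>

lemma card_residue_class:
  fixes M K :: nat and c :: int
  assumes "M \<ge> 1"
  shows "card {x \<in> {1..M * K}. int M dvd int x - c} = K"
proof -
  \<comment> \<open>\<open>x\<close> lies in the class of \<open>c\<close> iff \<open>x - 1\<close> leaves the remainder \<open>r\<close>.\<close>
  define r where "r = nat ((c - 1) mod int M)"
  have r: "r < M" "int r = (c - 1) mod int M"
    using assms by (auto simp: r_def nat_less_iff)
  have iff: "int M dvd int x - c \<longleftrightarrow> (x - 1) mod M = r" if "x \<ge> 1" for x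
  proof -
    have "int M dvd int x - c \<longleftrightarrow> int (x - 1) mod int M = (c - 1) mod int M"
      using that by (simp add: mod_eq_dvd_iff of_nat_diff)
    then show ?thesis by (simp flip: r(2) of_nat_mod)
  qed
  have "{x \<in> {1..M * K}. int M dvd int x - c} = (\<lambda>k. M * k + r + 1) ` {..<K}"
  proof (intro Set.equalityI subsetI)
    fix x assume x: "x \<in> {x \<in> {1..M * K}. int M dvd int x - c}"
    then have "x - 1 < M * K" "(x - 1) mod M = r" using iff by auto
    then have "x = M * ((x - 1) div M) + r + 1" "(x - 1) div M < K"
      using x mult_div_mod_eq[of M "x - 1"] by (auto simp: less_mult_imp_div_less mult.commute)
    then show "x \<in> (\<lambda>k. M * k + r + 1) ` {..<K}" by blast
  next
    fix x assume "x \<in> (\<lambda>k. M * k + r + 1) ` {..<K}"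
    then obtain k where k: "x = M * k + r + 1" "k < K" by auto
    have "M * k + M \<le> M * K" using k(2) mult_le_mono2[of "Suc k" K M] by simp
    then show "x \<in> {x \<in> {1..M * K}. int M dvd int x - c}"
      using iff[of x] k r(1) by simp
  qed
  moreover have "inj_on (\<lambda>k. M * k + r + 1) {..<K}" using assms by (auto simp: inj_on_def)
  ultimately show ?thesis by (simp add: card_image)
qed

lemma card_residue_class_power:
  assumes "a \<le> e"
  shows "card {x::nat. 1 \<le> x \<and> x \<le> 2 ^ e \<and> 2 ^ a dvd int x - c} = 2 ^ (e - a)"
proof -
  have "(2::nat) ^ e = 2 ^ a * 2 ^ (e - a)" using assms by (simp flip: power_add)
  then show ?thesis using card_residue_class[of "2 ^ a" "2 ^ (e - a)" c] by simp
qed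

lemma card_odd:
  assumes "e \<ge> 1"
  shows "card {x::nat. 1 \<le> x \<and> x \<le> 2 ^ e \<and> odd x} = 2 ^ (e - 1)"
proof -
  have "2 ^ 1 dvd int x - 1 \<longleftrightarrow> odd x" for x by simp
  then show ?thesis using card_residue_class_power[OF assms, of 1] by simp
qed

text \<open>
  The conditions are void, since \<open>2 ^ a\<close> and \<open>2 ^ b\<close> divide 4.
\<close>

lemma card_near_signs_small:
  assumes "e \<ge> 1" "a \<le> 2" "b \<le> 2"
  shows "card {x::nat. 1 \<le> x \<and> x \<le> 2 ^ e \<and> odd x \<and>
    (4 dvd int x - 1 \<longrightarrow> 2 ^ a dvd int x - 1) \<and> (4 dvd int x + 1 \<longrightarrow> 2 ^ b dvd int x + 1)}
    = 2 ^ (e - 1)"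
proof -
  have "(2::int) ^ k dvd z" if "k \<le> 2" "4 dvd z" for k z
    using le_imp_power_dvd[OF that(1), of "2::int"] that(2) by (auto intro: dvd_trans)
  then show ?thesis using card_odd[OF assms(1)] assms by simp
qed

text \<open>
  Now 4 divides \<open>2 ^ a\<close> and \<open>2 ^ b\<close>, so the set is the disjoint union of the residue classes of \<open>1\<close>
  modulo \<open>2 ^ a\<close> and of \<open>-1\<close> modulo \<open>2 ^ b\<close>.
\<close>

lemma card_near_signs_large:
  assumes "2 \<le> a" "a \<le> e" "2 \<le> b" "b \<le> e"
  shows "card {x::nat. 1 \<le> x \<and> x \<le> 2 ^ e \<and> odd x \<and>
    (4 dvd int x - 1 \<longrightarrow> 2 ^ a dvd int x - 1) \<and> (4 dvd int x + 1 \<longrightarrow> 2 ^ b dvd int x + 1)}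
    = 2 ^ (e - a) + 2 ^ (e - b)"
proof -
  define P where "P = {x::nat. 1 \<le> x \<and> x \<le> 2 ^ e \<and> 2 ^ a dvd int x - 1}"
  define Q where "Q = {x::nat. 1 \<le> x \<and> x \<le> 2 ^ e \<and> 2 ^ b dvd int x - (-1)}"
  have four: "4 dvd z" if "2 ^ k dvd z" "2 \<le> k" for k and z :: int
    using le_imp_power_dvd[OF that(2), of "2::int"] that(1) by (auto intro: dvd_trans)
  have P4: "4 dvd int x - 1" if "x \<in> P" for x using that four assms by (auto simp: P_def)
  have Q4: "4 dvd int x + 1" if "x \<in> Q" for x using that four assms by (auto simp: Q_def)
  have excl: "\<not> (4 dvd z - 1 \<and> 4 dvd z + 1)" for z :: int by presburger
  have odd: "odd x \<longleftrightarrow> 4 dvd int x - 1 \<or> 4 dvd int x + 1" for x by presburger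
  have "{x::nat. 1 \<le> x \<and> x \<le> 2 ^ e \<and> odd x \<and>
    (4 dvd int x - 1 \<longrightarrow> 2 ^ a dvd int x - 1) \<and> (4 dvd int x + 1 \<longrightarrow> 2 ^ b dvd int x + 1)} = P \<union> Q"
    (is "?S = _")
  proof (intro Set.equalityI subsetI)
    fix x assume "x \<in> ?S"
    then show "x \<in> P \<union> Q" using odd[of x] by (auto simp: P_def Q_def)
  next
    fix x assume x: "x \<in> P \<union> Q"
    then have "4 dvd int x - 1 \<or> 4 dvd int x + 1" using P4 Q4 by auto
    then have "odd x" using odd[of x] by simp
    then show "x \<in> ?S" using x P4[of x] Q4[of x] excl[of "int x"] by (auto simp: P_def Q_def)
  qed
  moreover have "P \<inter> Q = {}" using P4 Q4 excl by blast
  moreover have "finite P" "finite Q"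
    by (auto simp: P_def Q_def intro: finite_subset[of _ "{..2 ^ e}"])
  moreover have "card P = 2 ^ (e - a)" "card Q = 2 ^ (e - b)"
    unfolding P_def Q_def using assms by (simp_all only: card_residue_class_power)
  ultimately show ?thesis by (simp add: card_Un_disjoint)
qed

lemma two_times_powi: "e \<ge> 1 \<Longrightarrow> 2 * 2 powi (int e - 2) = (2::real) ^ (e - 1)"
proof -
  assume "e \<ge> 1"
  then have "(2::real) ^ (e - 1) = 2 powi (1 + (int e - 2))"
    by (simp flip: power_int_of_nat add: of_nat_diff)
  then show ?thesis by (subst (asm) power_int_add) simp_all
qed

lemma card_self_power_solutions:
  fixes n e :: nat
  assumes "n \<ge> 1" "e \<ge> 1"
    and a: "a = (e - multiplicity 2 n + 1) div 2"
    and b: "b = (if even n then a else e - 1)"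
  defines "S \<equiv> {x::nat. 1 \<le> x \<and> x \<le> 2 ^ e \<and> \<not> 2 dvd x \<and> [x ^ (x ^ n) = x] (mod 2 ^ e)}"
  shows "a \<le> 2 \<Longrightarrow> b \<le> 2 \<Longrightarrow> card S = 2 ^ (e - 1)"
    and "2 \<le> a \<Longrightarrow> 2 \<le> b \<Longrightarrow> card S = 2 ^ (e - a) + 2 ^ (e - b)"
proof -
  have S: "S = {x::nat. 1 \<le> x \<and> x \<le> 2 ^ e \<and> odd x \<and>
    (4 dvd int x - 1 \<longrightarrow> 2 ^ a dvd int x - 1) \<and> (4 dvd int x + 1 \<longrightarrow> 2 ^ b dvd int x + 1)}"
    unfolding S_def using self_power_cong_iff[OF assms(1,2) _ a b] by blast
  have le: "a \<le> e" "b \<le> e" using assms by auto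
  show "a \<le> 2 \<Longrightarrow> b \<le> 2 \<Longrightarrow> card S = 2 ^ (e - 1)"
    unfolding S by (rule card_near_signs_small[OF \<open>e \<ge> 1\<close>])
  show "2 \<le> a \<Longrightarrow> 2 \<le> b \<Longrightarrow> card S = 2 ^ (e - a) + 2 ^ (e - b)"
    unfolding S using le by (intro card_near_signs_large)
qed

theorem corollary11:
  fixes n :: nat
  assumes "n \<ge> 1"
  shows
    "(even n \<longrightarrow> (\<forall>e::nat. e \<ge> 1 \<longrightarrow>
        real (card {x::nat. 1 \<le> x \<and> x \<le> 2 ^ e \<and> \<not> 2 dvd x \<and> [x ^ (x ^ n) = x] (mod 2 ^ e)}) =
          (if e \<le> 4 + multiplicity 2 n then 2 * 2 powi (int e - 2)
           else 2 * 2 ^ ((e + multiplicity 2 n) div 2)))) \<and>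
     (odd n \<longrightarrow> (\<forall>e::nat. e \<ge> 1 \<longrightarrow>
        real (card {x::nat. 1 \<le> x \<and> x \<le> 2 ^ e \<and> \<not> 2 dvd x \<and> [x ^ (x ^ n) = x] (mod 2 ^ e)}) =
          (if e \<le> 3 then 2 * 2 powi (int e - 2)
           else 2 ^ (e div 2) + 2))) \<and>
     {x \<in> Z2. \<not> dvd_Z2 2 x \<and> omega2 x * angle2_power x (x ^ n) = x} = {1, -1}"
proof (intro conjI impI allI)
  fix e :: nat assume n: "even n" and e: "e \<ge> 1"
  let ?v = "multiplicity 2 n"
  let ?a = "(e - ?v + 1) div 2"
  note card = card_self_power_solutions[OF assms e refl, unfolded if_P[OF n], OF refl]
  show "real (card {x::nat. 1 \<le> x \<and> x \<le> 2 ^ e \<and> \<not> 2 dvd x \<and> [x ^ (x ^ n) = x] (mod 2 ^ e)}) =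
          (if e \<le> 4 + ?v then 2 * 2 powi (int e - 2) else 2 * 2 ^ ((e + ?v) div 2))"
  proof (cases "e \<le> 4 + ?v")
    case True
    then have "?a \<le> 2" by linarith
    then show ?thesis using True card(1) e by (simp add: two_times_powi)
  next
    case False
    then have "2 \<le> ?a" and "e - ?a = (e + ?v) div 2" by linarith+
    then show ?thesis using False card(2) by simp
  qed
next
  fix e :: nat assume n: "odd n" and e: "e \<ge> 1"
  have v: "multiplicity 2 n = 0" using n by (simp add: not_dvd_imp_multiplicity_0)
  let ?a = "(e + 1) div 2"
  note card = card_self_power_solutions[OF assms e refl, unfolded if_not_P[OF n] v diff_zero, OF refl]
  show "real (card {x::nat. 1 \<le> x \<and> x \<le> 2 ^ e \<and> \<not> 2 dvd x \<and> [x ^ (x ^ n) = x] (mod 2 ^ e)}) =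
          (if e \<le> 3 then 2 * 2 powi (int e - 2) else 2 ^ (e div 2) + 2)"
  proof (cases "e \<le> 3")
    case True
    then have "?a \<le> 2" "e - 1 \<le> 2" by linarith+
    then show ?thesis using True card(1) e by (simp add: two_times_powi)
  next
    case False
    then have "2 \<le> ?a" "2 \<le> e - 1" "e - ?a = e div 2" "e - (e - 1) = 1" by linarith+
    then show ?thesis using False card(2) by simp
  qed
qed (rule unit_solutions[OF assms])

end
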